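(* Assume the standing assumptions (S), let $M^{(N)}:=\frac1{\sqrt N}\big(\alpha(\tfrac{|i-j|}{N})X^{(N)}_{ij}\big)_{1\le i,j\le N}$, and define $$\varphi(x):=\int_0^1\alpha^2(|x-y|)\,dy\quad(x\in[0,1]),\qquad \varphi_0:=\int_0^1\varphi(x)\,dx,$$ and assume $\varphi_0>0$. Then the semicircle law holds for $\varphi_0^{-1/2}M^{(N)}$, i.e. $$\lim_{N\to\infty}\frac1N\mathbb E\Big(\operatorname{tr}\big(\varphi_0^{-1/2}M^{(N)}\big)^k\Big)=\begin{cases}C_{k/2}&k\text{ even},\\0&k\text{ odd},\end{cases}\qquad\text{for all }k\in\mathbb N,$$ where $C_n=\frac1{n+1}\binom{2n}{n}$, if and only if $\varphi(x)=\varphi_0$ for all $x\in[0,1]$.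
   Context: Standing assumptions (S): $\alpha:[0,1]\to\mathbb R$ is bounded and Riemann-integrable. For each $N\in\mathbb N$, $(X^{(N)}_{ij})_{1\le i,j\le N}$ are real random variables on a common probability space with $X^{(N)}_{ij}=X^{(N)}_{ji}$, $\mathbb E X^{(N)}_{ij}=0$, $\mathbb E (X^{(N)}_{ij})^2=1$, and $\sup_N\max_{i,j}\mathbb E|X^{(N)}_{ij}|^k\le R_k<\infty$ for every $k\ge 1$. For each $N$, $\sim$ is an equivalence relation on $\{1,\dots,N\}^2$ with $(p,q)\sim(q,p)$ for all $p,q$, satisfying, as $N\to\infty$: (C1) $\max_p\#\{(q,r,s)\in\{1,\dots,N\}^3:(p,q)\sim(r,s)\}=o(N^2)$; (C2) $\max_{p,q,r}\#\{s\in\{1,\dots,N\}:(p,q)\sim(r,s)\}\le B<\infty$ with $B$ independent of $N$; (C3) $\#\{(p,q,r)\in\{1,\dots,N\}^3:(p,q)\sim(q,r),\ r\neq p\}=o(N^2)$. Entries indexed by non-equivalent pairs are independent: for each $N$, the families $\{X^{(N)}_{pq}:(p,q)\in C\}$, $C$ ranging over the distinct $\sim$-equivalence classes, are mutually independent. *)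

theory Defs
  imports "HOL-Analysis.Analysis" "HOL-Probability.Probability"
begin

definition riemann_integrable_on :: "(real \<Rightarrow> real) \<Rightarrow> real \<Rightarrow> real \<Rightarrow> bool" where
  "riemann_integrable_on f a b \<longleftrightarrow>
     (\<exists>I. \<forall>e>0. \<exists>d>0. \<forall>p. p tagged_division_of {a..b} \<and> (\<lambda>x. ball x d) fine p \<longrightarrow>
         \<bar>(\<Sum>(x,K)\<in>p. Henstock_Kurzweil_Integration.content K * f x) - I\<bar> < e)"

text \<open>N x N matrices indexed by {1..N}, as functions nat => nat => real.\<close>
definition mmult :: "nat \<Rightarrow> (nat \<Rightarrow> nat \<Rightarrow> real) \<Rightarrow> (nat \<Rightarrow> nat \<Rightarrow> real) \<Rightarrow> nat \<Rightarrow> nat \<Rightarrow> real" where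
  "mmult N A B = (\<lambda>i j. \<Sum>l\<in>{1..N}. A i l * B l j)"

fun mpow :: "nat \<Rightarrow> (nat \<Rightarrow> nat \<Rightarrow> real) \<Rightarrow> nat \<Rightarrow> nat \<Rightarrow> nat \<Rightarrow> real" where
  "mpow N A 0 = (\<lambda>i j. if i = j then 1 else 0)"
| "mpow N A (Suc k) = mmult N A (mpow N A k)"

definition mtrace :: "nat \<Rightarrow> (nat \<Rightarrow> nat \<Rightarrow> real) \<Rightarrow> real" where
  "mtrace N A = (\<Sum>i\<in>{1..N}. A i i)"

definition catalan :: "nat \<Rightarrow> real" where
  "catalan n = real (2 * n choose n) / real (n + 1)"

definition bandM :: "(real \<Rightarrow> real) \<Rightarrow> (nat \<Rightarrow> nat \<Rightarrow> nat \<Rightarrow> 'a \<Rightarrow> real) \<Rightarrow> nat \<Rightarrow> 'a \<Rightarrow> nat \<Rightarrow> nat \<Rightarrow> real" where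
  "bandM \<alpha> X N \<omega> = (\<lambda>i j. (1 / sqrt (real N)) * \<alpha> (\<bar>real i - real j\<bar> / real N) * X N i j \<omega>)"

definition phi :: "(real \<Rightarrow> real) \<Rightarrow> real \<Rightarrow> real" where
  "phi \<alpha> x = integral {0..1} (\<lambda>y. (\<alpha> \<bar>x - y\<bar>)^2)"

definition phi0 :: "(real \<Rightarrow> real) \<Rightarrow> real" where
  "phi0 \<alpha> = integral {0..1} (phi \<alpha>)"

end

theory Submission
  imports Defs
begin

text \<open>
  Expanding the trace gives a sum over closed walks. By independence and \<open>C2\<close> only walks whose steps
  fall into classes of size two matter, so the joint moment of a walk may be replaced by a Wick sum
  over pairings. Reading a walk from left to right, the steps still waiting for their partner form a
  stack. As long as each step is paired with the top of the stack and retraces it, the stack is a path;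
  \<open>C3\<close> makes a pairing with the top that does not retrace it negligible, and \<open>C1\<close> makes a pairing with a
  deeper entry (a crossing) negligible. What remains are walks around trees, and closing a
  leaf at \<open>v\<close> contributes the row sum of the squared weights, which approximates
  \<open>phi (v / N) / phi0\<close> uniformly in \<open>v\<close>. If \<open>phi\<close> is constant, every leaf contributes 1 and the
  stack heights count Dyck paths. Conversely, the second and fourth moments force the variance of
  the row sums to vanish, so the continuous function \<open>phi\<close> is constant.
\<close>

section \<open>Walks and Wick sums\<close>

text \<open>The hypotheses on the classes have two strengths, and this shapes the argument. C2 holds
  for each step and vertex. It alone shows that the Wick sum over the continuations of any stack of
  height h has order N^(-h/2): an opened step has N targets and costs two weights of order N^(-1/2),
  while a pairing has boundedly many targets. C1 and C3 only count index triples; for one given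
  stack an unwanted pairing may be as large as a wanted one. So the error in passing from Wick sums
  to trees is not estimated stack by stack but summed over all vertex paths that the stack can be.
  After the first unwanted pairing the stack need no longer be a path, and only the crude bound from
  C2 is used. The Wick formula is applied to entries that need not be Gaussian. It is exact if every
  class occurs at most twice in the walk, and also if some class occurs exactly once, both sides
  then being 0. In all other walks every class occurs at least twice and one at least three times,
  which loses a factor N^(-1/2).\<close>

definition vlists :: "nat \<Rightarrow> nat \<Rightarrow> nat list set" where
  "vlists N m = {xs. set xs \<subseteq> {1..N} \<and> length xs = m}"

lemma vlists_0 [simp]: "vlists N 0 = {[]}"
  by (auto simp: vlists_def)

lemma finite_vlists [simp, intro]: "finite (vlists N m)"
  by (simp add: vlists_def finite_lists_length_eq)

lemma card_vlists: "card (vlists N m) = N ^ m"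
  by (simp add: vlists_def card_lists_length_eq)

lemma sum_vlists_Suc:
  "(\<Sum>xs\<in>vlists N (Suc m). f xs) = (\<Sum>u\<in>{1..N}. \<Sum>xs\<in>vlists N m. f (u # xs))"
proof -
  have eq: "vlists N (Suc m) = (\<lambda>(u, xs). u # xs) ` ({1..N} \<times> vlists N m)"
    by (auto simp: vlists_def length_Suc_conv image_iff)
  have inj: "inj_on (\<lambda>(u, xs). u # xs) ({1..N} \<times> vlists N m)"
    by (auto simp: inj_on_def)
  show ?thesis
    unfolding eq by (subst sum.reindex[OF inj]) (simp add: sum.cartesian_product o_def split_def)
qed

lemma sum_vlists_add:
  "(\<Sum>xs\<in>vlists N (m + n). f xs) = (\<Sum>xs\<in>vlists N m. \<Sum>ys\<in>vlists N n. f (xs @ ys))"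
  by (induction m arbitrary: f) (simp_all add: sum_vlists_Suc)

fun steps :: "nat list \<Rightarrow> (nat \<times> nat) list" where
  "steps (v # u # xs) = (v, u) # steps (u # xs)"
| "steps _ = []"

lemma length_steps [simp]: "length (steps xs) = length xs - 1"
  by (induction xs rule: steps.induct) auto

lemma set_steps: "set (steps xs) \<subseteq> set xs \<times> set xs"
  by (induction xs rule: steps.induct) auto

definition del_nth :: "nat \<Rightarrow> 'e list \<Rightarrow> 'e list" where
  "del_nth j xs = take j xs @ drop (Suc j) xs"

lemma length_del_nth: "j < length xs \<Longrightarrow> length (del_nth j xs) = length xs - 1"
  by (auto simp: del_nth_def)

lemma set_del_nth: "set (del_nth j xs) \<subseteq> set xs"
  by (auto simp: del_nth_def dest: in_set_takeD in_set_dropD)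

lemma del_nth_0_Cons [simp]: "del_nth 0 (x # xs) = xs"
  by (simp add: del_nth_def)

lemma mset_del_nth: "j < length xs \<Longrightarrow> add_mset (xs ! j) (mset (del_nth j xs)) = mset xs"
  using arg_cong[OF id_take_nth_drop[of j xs], of mset] by (simp add: del_nth_def)

lemma in_set_del_nth: "j < length xs \<Longrightarrow> x \<in> set xs \<Longrightarrow> x \<noteq> xs ! j \<Longrightarrow> x \<in> set (del_nth j xs)"
  using arg_cong[OF mset_del_nth[of j xs], of set_mset] by auto

text \<open>The Wick sum over all pairings of \<open>st @ es\<close> in which no two entries of \<open>st\<close> are paired.
  The entries of \<open>es\<close> are read from left to right; each either waits on the stack \<open>st\<close> for a later
  partner or is paired with an entry of \<open>st\<close>. A pairing is noncrossing precisely
  if every partner is the top of the stack.\<close>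

fun wick :: "('e \<Rightarrow> 'e \<Rightarrow> real) \<Rightarrow> 'e list \<Rightarrow> 'e list \<Rightarrow> real" where
  "wick c st [] = (if st = [] then 1 else 0)"
| "wick c st (e # es) =
     wick c (e # st) es + (\<Sum>j<length st. c (st ! j) e * wick c (del_nth j st) es)"

text \<open>Every step either waits or chooses one of the stack entries. One plus the stack height
  plus the number of unread steps never grows along the recursion, so it bounds the number of
  branches at each of the \<open>length es\<close> steps.\<close>

lemma wick_bound:
  assumes "\<And>e f. e \<in> S \<Longrightarrow> f \<in> S \<Longrightarrow> \<bar>c e f\<bar> \<le> 1" "set st \<subseteq> S" "set es \<subseteq> S"
  shows "\<bar>wick c st es\<bar> \<le> real (1 + length st + length es) ^ length es"
  using assms(2,3)
proof (induction es arbitrary: st)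
  case Nil
  then show ?case by simp
next
  case (Cons e es)
  let ?K = "real (1 + length st + length (e # es))"
  have 1: "\<bar>wick c (e # st) es\<bar> \<le> ?K ^ length es"
    using Cons.IH[of "e # st"] Cons.prems by simp
  have 2: "\<bar>c (st ! j) e * wick c (del_nth j st) es\<bar> \<le> ?K ^ length es" if "j < length st" for j
  proof -
    have "\<bar>wick c (del_nth j st) es\<bar> \<le> real (1 + length (del_nth j st) + length es) ^ length es"
      using Cons.IH[of "del_nth j st"] Cons.prems set_del_nth[of j st] by auto
    also have "\<dots> \<le> ?K ^ length es"
      using that by (intro power_mono) (auto simp: length_del_nth)
    finally have "\<bar>wick c (del_nth j st) es\<bar> \<le> ?K ^ length es" .
    moreover have "\<bar>c (st ! j) e\<bar> \<le> 1"
      using assms(1) that Cons.prems by (meson in_mono list.set_intros(1) nth_mem)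
    ultimately have "\<bar>c (st ! j) e\<bar> * \<bar>wick c (del_nth j st) es\<bar> \<le> 1 * ?K ^ length es"
      by (intro mult_mono) auto
    then show ?thesis by (simp add: abs_mult)
  qed
  have "\<bar>wick c st (e # es)\<bar> \<le> \<bar>wick c (e # st) es\<bar>
      + (\<Sum>j<length st. \<bar>c (st ! j) e * wick c (del_nth j st) es\<bar>)"
    unfolding wick.simps by (rule order_trans[OF abs_triangle_ineq add_left_mono[OF sum_abs]])
  also have "\<dots> \<le> ?K ^ length es + real (length st) * ?K ^ length es"
    using 1 sum_bounded_above[of "{..<length st}" "\<lambda>j. \<bar>c (st ! j) e * wick c (del_nth j st) es\<bar>"] 2
    by (intro add_mono) auto
  also have "\<dots> = (1 + real (length st)) * ?K ^ length es" by (simp add: algebra_simps)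
  also have "\<dots> \<le> ?K * ?K ^ length es"
    by (intro mult_right_mono) auto
  finally show ?case by simp
qed

text \<open>Once on the stack, \<open>x\<close> leaves it only through a factor \<open>c x f\<close>
  with a later \<open>f\<close>, and the recursion ends with 0 unless the stack is empty. Deleting
  another entry of the same value also produces such a factor.\<close>

lemma wick_eq_0_stack:
  assumes "x \<in> set st" "\<And>f. f \<in> set es \<Longrightarrow> c x f = 0"
  shows "wick c st es = 0"
  using assms
proof (induction es arbitrary: st)
  case Nil
  then show ?case by auto
next
  case (Cons e es)
  have "c (st ! j) e * wick c (del_nth j st) es = 0" if "j < length st" for j
  proof (cases "st ! j = x")
    case True
    then show ?thesis using Cons.prems(2)[of e] by simp
  next
    case False
    then have "x \<in> set (del_nth j st)" using in_set_del_nth[of j st x] that Cons.prems by auto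
    then show ?thesis using Cons.IH Cons.prems by simp
  qed
  moreover have "wick c (e # st) es = 0" using Cons by simp
  ultimately show ?case
    unfolding wick.simps by (metis (no_types, lifting) add_0 lessThan_iff sum.neutral)
qed

text \<open>Both ways of treating \<open>x\<close> fail: pairing it with an earlier entry gives a
  zero factor, and putting it on the stack leads to \<open>wick_eq_0_stack\<close>. Needed for a
  class that a walk meets only once.\<close>

lemma wick_eq_0_unpaired:
  assumes "\<And>f. f \<in> set st \<union> set es1 \<Longrightarrow> c f x = 0" "\<And>f. f \<in> set es2 \<Longrightarrow> c x f = 0"
  shows "wick c st (es1 @ x # es2) = 0"
  using assms
proof (induction es1 arbitrary: st)
  case Nil
  then show ?case using wick_eq_0_stack[of x "x # st" es2 c] by simp
next
  case (Cons e es1)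
  have "wick c (del_nth j st) (es1 @ x # es2) = 0" for j
    using Cons.prems set_del_nth[of j st] by (intro Cons.IH) auto
  moreover have "wick c (e # st) (es1 @ x # es2) = 0"
    using Cons.prems by (intro Cons.IH) auto
  ultimately show ?case by simp
qed

section \<open>Joint moments of the entries\<close>

text \<open>A substitute for Hoelder's inequality: the factor of largest modulus dominates the
  product, and its power is one of the summands. This reduces mixed moments to moments of single
  entries.\<close>

lemma abs_prod_list_le_sum_power:
  fixes f :: "'e \<Rightarrow> real"
  assumes "xs \<noteq> []"
  shows "\<bar>\<Prod>x\<leftarrow>xs. f x\<bar> \<le> (\<Sum>x\<leftarrow>xs. \<bar>f x\<bar> ^ length xs)"
proof -
  have "Max ((\<lambda>x. \<bar>f x\<bar>) ` set xs) \<in> (\<lambda>x. \<bar>f x\<bar>) ` set xs"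
    using assms by (intro Max_in) auto
  then obtain y where y: "y \<in> set xs" "Max ((\<lambda>x. \<bar>f x\<bar>) ` set xs) = \<bar>f y\<bar>" by blast
  have le: "\<bar>f x\<bar> \<le> \<bar>f y\<bar>" if "x \<in> set xs" for x
    unfolding y(2)[symmetric] using that by simp
  have "\<bar>\<Prod>x\<leftarrow>zs. f x\<bar> \<le> \<bar>f y\<bar> ^ length zs" if "set zs \<subseteq> set xs" for zs
    using that
  proof (induction zs)
    case (Cons z zs)
    then show ?case using le[of z] by (auto simp: abs_mult intro!: mult_mono)
  qed simp
  then have "\<bar>\<Prod>x\<leftarrow>xs. f x\<bar> \<le> \<bar>f y\<bar> ^ length xs" by simp
  also have "\<dots> \<le> (\<Sum>x\<leftarrow>xs. \<bar>f x\<bar> ^ length xs)"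
    using y(1) by (intro member_le_sum_list) auto
  finally show ?thesis .
qed

text \<open>\<open>B\<close> is a parameter, so that later constants can be written in terms of it;
  the theorem obtains it from its existential hypothesis.\<close>

locale correlated_ensemble = prob_space M for M :: "'a measure" +
  fixes X :: "nat \<Rightarrow> nat \<Rightarrow> nat \<Rightarrow> 'a \<Rightarrow> real"
    and rel :: "nat \<Rightarrow> ((nat \<times> nat) \<times> (nat \<times> nat)) set"
    and R :: "nat \<Rightarrow> real"
    and B :: nat
  assumes meas [measurable]: "\<And>N i j. X N i j \<in> borel_measurable M"
    and symm: "\<And>N i j \<omega>. X N i j \<omega> = X N j i \<omega>"
    and mean0: "\<And>N i j. i \<in> {1..N} \<Longrightarrow> j \<in> {1..N} \<Longrightarrow> expectation (X N i j) = 0"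
    and var1: "\<And>N i j. i \<in> {1..N} \<Longrightarrow> j \<in> {1..N} \<Longrightarrow> expectation (\<lambda>\<omega>. (X N i j \<omega>)^2) = 1"
    and mom_int: "\<And>N i j k. i \<in> {1..N} \<Longrightarrow> j \<in> {1..N} \<Longrightarrow> k \<ge> 1 \<Longrightarrow>
                    integrable M (\<lambda>\<omega>. \<bar>X N i j \<omega>\<bar> ^ k)"
    and mom_bdd: "\<And>N i j k. i \<in> {1..N} \<Longrightarrow> j \<in> {1..N} \<Longrightarrow> k \<ge> 1 \<Longrightarrow>
                    expectation (\<lambda>\<omega>. \<bar>X N i j \<omega>\<bar> ^ k) \<le> R k"
    and equiv: "\<And>N. equiv ({1..N} \<times> {1..N}) (rel N)"
    and rel_swap: "\<And>N p q. p \<in> {1..N} \<Longrightarrow> q \<in> {1..N} \<Longrightarrow> ((p, q), (q, p)) \<in> rel N"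
    and C1: "(\<lambda>N. real (Max ((\<lambda>p. card {(q, r, s). q \<in> {1..N} \<and> r \<in> {1..N} \<and> s \<in> {1..N}
                      \<and> ((p, q), (r, s)) \<in> rel N}) ` {1..N})) / (real N)^2) \<longlonglongrightarrow> 0"
    and C2: "\<And>N p q r. p \<in> {1..N} \<Longrightarrow> q \<in> {1..N} \<Longrightarrow> r \<in> {1..N} \<Longrightarrow>
                card {s \<in> {1..N}. ((p, q), (r, s)) \<in> rel N} \<le> B"
    and C3: "(\<lambda>N. real (card {(p, q, r). p \<in> {1..N} \<and> q \<in> {1..N} \<and> r \<in> {1..N}
                      \<and> ((p, q), (q, r)) \<in> rel N \<and> r \<noteq> p}) / (real N)^2) \<longlonglongrightarrow> 0"
    and indep: "\<And>N. indep_vars (\<lambda>C. PiM C (\<lambda>_. borel))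
                  (\<lambda>C \<omega>. restrict (\<lambda>(p, q). X N p q \<omega>) C) (({1..N} \<times> {1..N}) // rel N)"
begin

section \<open>Integrability of joint moments and their factorisation over classes\<close>

definition grid :: "nat \<Rightarrow> (nat \<times> nat) set" where
  "grid N = {1..N} \<times> {1..N}"

definition entry :: "nat \<Rightarrow> nat \<times> nat \<Rightarrow> 'a \<Rightarrow> real" where
  "entry N e \<omega> = X N (fst e) (snd e) \<omega>"

definition joint :: "nat \<Rightarrow> (nat \<times> nat) list \<Rightarrow> real" where
  "joint N es = expectation (\<lambda>\<omega>. \<Prod>e\<leftarrow>es. entry N e \<omega>)"

definition cov :: "nat \<Rightarrow> nat \<times> nat \<Rightarrow> nat \<times> nat \<Rightarrow> real" where
  "cov N e f = joint N [e, f]"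

lemma entry_measurable [measurable]: "entry N e \<in> borel_measurable M"
  unfolding entry_def[abs_def] by measurable

lemma prod_entry_measurable [measurable]: "(\<lambda>\<omega>. \<Prod>e\<leftarrow>es. entry N e \<omega>) \<in> borel_measurable M"
  by (induction es) simp_all

lemma rel_refl: "e \<in> grid N \<Longrightarrow> (e, e) \<in> rel N"
  using equiv[of N] by (auto simp: equiv_def refl_on_def grid_def)

lemma rel_sym: "(e, f) \<in> rel N \<Longrightarrow> (f, e) \<in> rel N"
  using equiv[of N] by (auto simp: equiv_def dest: symD)

lemma rel_trans: "(e, f) \<in> rel N \<Longrightarrow> (f, g) \<in> rel N \<Longrightarrow> (e, g) \<in> rel N"
  using equiv[of N] by (auto simp: equiv_def dest: transD)

lemma
  assumes "set es \<subseteq> grid N" "k \<ge> 1"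
  shows integrable_sum_entry_power: "integrable M (\<lambda>\<omega>. \<Sum>e\<leftarrow>es. \<bar>entry N e \<omega>\<bar> ^ k)"
    and expectation_sum_entry_power:
      "expectation (\<lambda>\<omega>. \<Sum>e\<leftarrow>es. \<bar>entry N e \<omega>\<bar> ^ k) \<le> real (length es) * R k"
proof -
  have "integrable M (\<lambda>\<omega>. \<Sum>e\<leftarrow>es. \<bar>entry N e \<omega>\<bar> ^ k) \<and>
    expectation (\<lambda>\<omega>. \<Sum>e\<leftarrow>es. \<bar>entry N e \<omega>\<bar> ^ k) \<le> real (length es) * R k"
    using assms(1)
  proof (induction es)
    case (Cons e es)
    have "integrable M (\<lambda>\<omega>. \<bar>entry N e \<omega>\<bar> ^ k)" "expectation (\<lambda>\<omega>. \<bar>entry N e \<omega>\<bar> ^ k) \<le> R k"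
      using Cons.prems assms(2) mom_int[of "fst e" N "snd e" k] mom_bdd[of "fst e" N "snd e" k]
      by (auto simp: grid_def entry_def)
    then show ?case using Cons by (auto simp: algebra_simps)
  qed simp
  then show "integrable M (\<lambda>\<omega>. \<Sum>e\<leftarrow>es. \<bar>entry N e \<omega>\<bar> ^ k)"
    "expectation (\<lambda>\<omega>. \<Sum>e\<leftarrow>es. \<bar>entry N e \<omega>\<bar> ^ k) \<le> real (length es) * R k" by auto
qed

lemma integrable_prod_entry:
  assumes "set es \<subseteq> grid N"
  shows "integrable M (\<lambda>\<omega>. \<Prod>e\<leftarrow>es. entry N e \<omega>)"
proof (cases "es = []")
  case False
  show ?thesis
  proof (rule Bochner_Integration.integrable_bound)
    show "integrable M (\<lambda>\<omega>. \<Sum>e\<leftarrow>es. \<bar>entry N e \<omega>\<bar> ^ length es)"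
      using False assms by (intro integrable_sum_entry_power) (auto simp: Suc_le_eq)
    show "AE \<omega> in M. norm (\<Prod>e\<leftarrow>es. entry N e \<omega>) \<le> norm (\<Sum>e\<leftarrow>es. \<bar>entry N e \<omega>\<bar> ^ length es)"
      using abs_prod_list_le_sum_power[OF False] by (auto intro!: AE_I2 order_trans[OF _ abs_ge_self])
  qed simp
qed simp

text \<open>The summand 1 covers the empty list, whose moment is 1. What matters later is that the
  bound depends only on the length and not on \<open>N\<close>.\<close>

lemma joint_bound:
  assumes "set es \<subseteq> grid N"
  shows "\<bar>joint N es\<bar> \<le> 1 + real (length es) * \<bar>R (length es)\<bar>"
proof (cases "es = []")
  case True
  then show ?thesis by (simp add: joint_def prob_space)
next
  case False
  have "\<bar>joint N es\<bar> \<le> expectation (\<lambda>\<omega>. \<bar>\<Prod>e\<leftarrow>es. entry N e \<omega>\<bar>)"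
    unfolding joint_def by (rule integral_abs_bound)
  also have "\<dots> \<le> expectation (\<lambda>\<omega>. \<Sum>e\<leftarrow>es. \<bar>entry N e \<omega>\<bar> ^ length es)"
    using False assms
    by (intro integral_mono integrable_abs integrable_prod_entry integrable_sum_entry_power
        abs_prod_list_le_sum_power) (auto simp: Suc_le_eq)
  also have "\<dots> \<le> real (length es) * R (length es)"
    using False assms by (intro expectation_sum_entry_power) (auto simp: Suc_le_eq)
  also have "\<dots> \<le> 1 + real (length es) * \<bar>R (length es)\<bar>"
    by (simp add: mult_left_mono add_increasing)
  finally show ?thesis .
qed

lemma joint_mset_cong: "mset es = mset fs \<Longrightarrow> joint N es = joint N fs"
  unfolding joint_def by (metis (no_types) mset_map prod_mset_prod_list)

lemma joint_singleton: "e \<in> grid N \<Longrightarrow> joint N [e] = 0"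
  using mean0[of "fst e" N "snd e"] by (auto simp: joint_def entry_def grid_def)

text \<open>Independence is stated for the vectors of all entries of a class, so both products have
  to be exhibited as measurable functions of two disjoint groups of such vectors.\<close>

lemma joint_append:
  assumes "set es \<subseteq> grid N" "set fs \<subseteq> grid N"
    and "\<And>e f. e \<in> set es \<Longrightarrow> f \<in> set fs \<Longrightarrow> (e, f) \<notin> rel N"
  shows "joint N (es @ fs) = joint N es * joint N fs"
proof -
  let ?cl = "\<lambda>e. rel N `` {e}"
  let ?A = "?cl ` set es" and ?B = "?cl ` set fs"
  let ?Y = "\<lambda>C \<omega>. restrict (\<lambda>(p, q). X N p q \<omega>) C"
  \<comment> \<open>\<open>?P\<close> reads each factor off the vector of its own class; reflexivity
    of \<open>rel N\<close> guarantees that this coordinate is present.\<close>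
  let ?P = "\<lambda>es (g :: (nat \<times> nat) set \<Rightarrow> nat \<times> nat \<Rightarrow> real). \<Prod>e\<leftarrow>es. g (?cl e) e"
  have disj: "?A \<inter> ?B = {}"
  proof (rule ccontr)
    assume "?A \<inter> ?B \<noteq> {}"
    then obtain e f where ef: "e \<in> set es" "f \<in> set fs" "?cl e = ?cl f" by blast
    moreover from ef have "(f, f) \<in> rel N" using assms rel_refl by blast
    ultimately have "(e, f) \<in> rel N" by blast
    with ef assms(3) show False by blast
  qed
  have sub: "?A \<subseteq> ({1..N} \<times> {1..N}) // rel N" "?B \<subseteq> ({1..N} \<times> {1..N}) // rel N"
    using assms unfolding grid_def by (auto intro!: quotientI)
  have "indep_var (PiM ?A (\<lambda>C. PiM C (\<lambda>_. borel))) (\<lambda>\<omega>. restrict (\<lambda>C. ?Y C \<omega>) ?A)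
     (PiM ?B (\<lambda>C. PiM C (\<lambda>_. borel))) (\<lambda>\<omega>. restrict (\<lambda>C. ?Y C \<omega>) ?B)"
    by (rule indep_var_restrict[OF indep disj sub])
  moreover have mP: "?P gs \<in> borel_measurable (PiM (?cl ` set gs) (\<lambda>C. PiM C (\<lambda>_. borel)))"
    if "set gs \<subseteq> grid N" for gs
  proof -
    have "?P hs \<in> borel_measurable (PiM (?cl ` set gs) (\<lambda>C. PiM C (\<lambda>_. borel)))"
      if "set hs \<subseteq> set gs" for hs
      using that
    proof (induction hs)
      case (Cons h hs)
      have h: "?cl h \<in> ?cl ` set gs" "h \<in> ?cl h" using Cons.prems \<open>set gs \<subseteq> grid N\<close> rel_refl[of h N] by auto
      have "(\<lambda>g. g (?cl h) h) \<in> borel_measurable (PiM (?cl ` set gs) (\<lambda>C. PiM C (\<lambda>_. borel)))"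
        using measurable_component_singleton[OF h(1), of "\<lambda>C. PiM C (\<lambda>_. borel)"]
          measurable_component_singleton[OF h(2), of "\<lambda>_. borel"]
        by (rule measurable_compose)
      moreover have "?P hs \<in> borel_measurable (PiM (?cl ` set gs) (\<lambda>C. PiM C (\<lambda>_. borel)))"
        using Cons by simp
      ultimately show ?case unfolding list.map prod_list.Cons by (rule borel_measurable_times)
    qed simp
    then show ?thesis by simp
  qed
  ultimately have "indep_var borel (?P es \<circ> (\<lambda>\<omega>. restrict (\<lambda>C. ?Y C \<omega>) ?A))
      borel (?P fs \<circ> (\<lambda>\<omega>. restrict (\<lambda>C. ?Y C \<omega>) ?B))"
    using assms by (intro indep_var_compose[where ?M1.0 = "PiM ?A (\<lambda>C. PiM C (\<lambda>_. borel))"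
          and ?M2.0 = "PiM ?B (\<lambda>C. PiM C (\<lambda>_. borel))"]) auto
  moreover have "?P gs \<circ> (\<lambda>\<omega>. restrict (\<lambda>C. ?Y C \<omega>) (?cl ` set gs)) = (\<lambda>\<omega>. \<Prod>e\<leftarrow>gs. entry N e \<omega>)"
    if "set gs \<subseteq> grid N" for gs
  proof -
    have "(e, e) \<in> rel N" if "e \<in> set gs" for e using that \<open>set gs \<subseteq> grid N\<close> rel_refl by blast
    then show ?thesis
      by (auto simp: fun_eq_iff entry_def split_def intro!: arg_cong[where f = prod_list])
  qed
  ultimately have "indep_var borel (\<lambda>\<omega>. \<Prod>e\<leftarrow>es. entry N e \<omega>) borel (\<lambda>\<omega>. \<Prod>e\<leftarrow>fs. entry N e \<omega>)"
    using assms by simp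
  from indep_var_lebesgue_integral[OF this integrable_prod_entry integrable_prod_entry] assms
  show ?thesis by (simp add: joint_def)
qed

lemma cov_eq_0:
  assumes "e \<in> grid N" "f \<in> grid N" "(e, f) \<notin> rel N"
  shows "cov N e f = 0"
  using joint_append[of "[e]" N "[f]"] joint_singleton[of e N] assms by (simp add: cov_def)

lemma cov_swap: "p \<in> {1..N} \<Longrightarrow> q \<in> {1..N} \<Longrightarrow> cov N (p, q) (q, p) = 1"
  using var1[of p N q] symm[of N p q] by (simp add: cov_def joint_def entry_def power2_eq_square)

text \<open>The inequality |x y| \<le> (x^2 + y^2) / 2 together with unit variances takes the place
  of Cauchy-Schwarz.\<close>

lemma abs_cov_le_1:
  assumes "e \<in> grid N" "f \<in> grid N"
  shows "\<bar>cov N e f\<bar> \<le> 1"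
proof -
  have sq: "integrable M (\<lambda>\<omega>. (entry N g \<omega>)\<^sup>2)" "expectation (\<lambda>\<omega>. (entry N g \<omega>)\<^sup>2) = 1"
    if "g \<in> grid N" for g
    using that mom_int[of "fst g" N "snd g" 2] var1[of "fst g" N "snd g"]
    by (auto simp: entry_def grid_def)
  have "\<bar>cov N e f\<bar> \<le> expectation (\<lambda>\<omega>. \<bar>\<Prod>g\<leftarrow>[e, f]. entry N g \<omega>\<bar>)"
    unfolding cov_def joint_def by (rule integral_abs_bound)
  also have "\<dots> \<le> expectation (\<lambda>\<omega>. ((entry N e \<omega>)\<^sup>2 + (entry N f \<omega>)\<^sup>2) / 2)"
  proof (intro integral_mono integrable_abs integrable_prod_entry)
    show "integrable M (\<lambda>\<omega>. ((entry N e \<omega>)\<^sup>2 + (entry N f \<omega>)\<^sup>2) / 2)"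
      using sq assms by auto
    show "\<bar>\<Prod>g\<leftarrow>[e, f]. entry N g \<omega>\<bar> \<le> ((entry N e \<omega>)\<^sup>2 + (entry N f \<omega>)\<^sup>2) / 2" for \<omega>
      using sum_squares_bound[of "\<bar>entry N e \<omega>\<bar>" "\<bar>entry N f \<omega>\<bar>"] by (simp add: abs_mult)
  qed (use assms in auto)
  also have "\<dots> = 1" using sq assms by simp
  finally show ?thesis .
qed

section \<open>Comparison of joint moments with Wick sums by class sizes\<close>

definition class_count :: "nat \<Rightarrow> nat \<times> nat \<Rightarrow> (nat \<times> nat) list \<Rightarrow> nat" where
  "class_count N e es = length (filter (\<lambda>f. (e, f) \<in> rel N) es)"

definition num_classes :: "nat \<Rightarrow> (nat \<times> nat) list \<Rightarrow> nat" where
  "num_classes N es = card ((\<lambda>e. rel N `` {e}) ` set es)"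

lemma class_count_mset: "class_count N e es = size (filter_mset (\<lambda>f. (e, f) \<in> rel N) (mset es))"
  by (simp add: class_count_def flip: mset_filter)

lemma class_count_mset_cong: "mset es = mset fs \<Longrightarrow> class_count N e es = class_count N e fs"
  by (simp add: class_count_mset)

lemma class_count_mset_mono: "mset es \<subseteq># mset fs \<Longrightarrow> class_count N e es \<le> class_count N e fs"
  unfolding class_count_mset by (intro size_mset_mono multiset_filter_mono)

lemma rel_class_eq_iff: "e \<in> grid N \<Longrightarrow> f \<in> grid N \<Longrightarrow> rel N `` {e} = rel N `` {f} \<longleftrightarrow> (e, f) \<in> rel N"
  using eq_equiv_class_iff[OF equiv[of N], of e f] by (simp add: grid_def)

text \<open>With at most two members per class, independence splits the moment into one covariance
  per class, and only the pairing inside the classes survives in the Wick sum. The induction keeps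
  the stack free of equivalent entries, so a new step has at most one possible partner
  there.\<close>

lemma joint_eq_wick:
  assumes "set (st @ es) \<subseteq> grid N" "sorted_wrt (\<lambda>e f. (e, f) \<notin> rel N) st"
    and "\<And>e. e \<in> set (st @ es) \<Longrightarrow> class_count N e (st @ es) \<le> 2"
  shows "joint N (st @ es) = wick (cov N) st es"
  using assms
proof (induction es arbitrary: st)
  case Nil
  show ?case
  proof (cases st)
    case Nil
    then show ?thesis by (simp add: joint_def prob_space)
  next
    case (Cons x st')
    then have "joint N (st @ []) = joint N [x] * joint N st'"
      using joint_append[of "[x]" N st'] Nil.prems by simp
    also have "\<dots> = 0" using Nil.prems Cons by (simp add: joint_singleton)
    finally show ?thesis using Cons by simp
  qed
next
  case (Cons e es)
  show ?case
  proof (cases "\<exists>x\<in>set st. (x, e) \<in> rel N")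
    case True
    then obtain j where j: "j < length st" "(st ! j, e) \<in> rel N" by (auto simp: in_set_conv_nth)
    let ?x = "st ! j" and ?rest = "del_nth j st @ es"
    have ms: "mset (st @ e # es) = add_mset ?x (add_mset e (mset ?rest))"
      using mset_del_nth[OF j(1)] by simp
    have rest: "set ?rest \<subseteq> set (st @ e # es)" using set_del_nth[of j st] by auto
    \<comment> \<open>\<open>?x\<close> and \<open>e\<close> already fill their class, since
      \<open>class_count\<close> is at most 2. Hence pairing \<open>e\<close> with \<open>?x\<close>
      is the only branch of the recursion that can survive.\<close>
    have not_e: "(e, y) \<notin> rel N" if "y \<in> set ?rest" for y
    proof -
      have "class_count N e (st @ e # es) = 2 + size (filter_mset (\<lambda>f. (e, f) \<in> rel N) (mset ?rest))"
        using rel_sym[OF j(2)] Cons.prems(1) rel_refl[of e N] by (simp only: class_count_mset ms) simp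
      moreover have "class_count N e (st @ e # es) \<le> 2" using Cons.prems(3) by simp
      ultimately have "filter_mset (\<lambda>f. (e, f) \<in> rel N) (mset ?rest) = {#}" by simp
      then have "filter (\<lambda>f. (e, f) \<in> rel N) ?rest = []"
        by (metis mset_filter mset_zero_iff)
      then show ?thesis using that by (metis filter_empty_conv)
    qed
    have e: "e \<in> grid N" using Cons.prems by auto
    have grid: "y \<in> grid N" if "y \<in> set ?rest" for y using that rest Cons.prems(1) by blast
    have "wick (cov N) (e # st) es = 0"
      by (rule wick_eq_0_stack[of e]) (use not_e grid e in \<open>auto intro!: cov_eq_0\<close>)
    moreover have "(\<Sum>i<length st. cov N (st ! i) e * wick (cov N) (del_nth i st) es) =
        (\<Sum>i\<in>{j}. cov N (st ! i) e * wick (cov N) (del_nth i st) es)"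
    proof (rule sum.mono_neutral_right)
      show "\<forall>i\<in>{..<length st} - {j}. cov N (st ! i) e * wick (cov N) (del_nth i st) es = 0"
      proof
        fix i assume i: "i \<in> {..<length st} - {j}"
        have "st ! i \<in> set (del_nth j st)"
        proof (cases "i < j")
          case True
          then have "st ! i \<in> set (take j st)" using j by (auto simp: in_set_conv_nth intro!: exI[of _ i])
          then show ?thesis by (simp add: del_nth_def)
        next
          case False
          then have "st ! i \<in> set (drop (Suc j) st)" using i
            by (auto simp: in_set_conv_nth intro!: exI[of _ "i - Suc j"])
          then show ?thesis by (simp add: del_nth_def)
        qed
        then have "cov N (st ! i) e = 0"
          using not_e[of "st ! i"] grid[of "st ! i"] e rel_sym[of "st ! i" e N]
          by (intro cov_eq_0) auto
        then show "cov N (st ! i) e * wick (cov N) (del_nth i st) es = 0" by simp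
      qed
    qed (use j in auto)
    ultimately have "wick (cov N) st (e # es) = cov N ?x e * wick (cov N) (del_nth j st) es" by simp
    also have "wick (cov N) (del_nth j st) es = joint N ?rest"
    proof (rule Cons.IH[symmetric])
      show "sorted_wrt (\<lambda>e f. (e, f) \<notin> rel N) (del_nth j st)"
      proof -
        have "sorted_wrt (\<lambda>e f. (e, f) \<notin> rel N) (take j st @ st ! j # drop (Suc j) st)"
          using Cons.prems(2) by (simp add: id_take_nth_drop[OF j(1), symmetric])
        then show ?thesis by (simp add: del_nth_def sorted_wrt_append)
      qed
      show "class_count N f ?rest \<le> 2" if "f \<in> set ?rest" for f
      proof -
        have "class_count N f ?rest \<le> class_count N f (st @ e # es)"
          by (rule class_count_mset_mono) (simp only: ms, metis add_mset_add_single mset_subset_eq_add_left subset_mset.order_trans)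
        also have "\<dots> \<le> 2" using that rest Cons.prems(3) by blast
        finally show ?thesis .
      qed
    qed (use grid in auto)
    also have "cov N ?x e * joint N ?rest = joint N ([?x, e] @ ?rest)"
      unfolding cov_def
    proof (rule joint_append[symmetric])
      show "(f, g) \<notin> rel N" if "f \<in> set [?x, e]" "g \<in> set ?rest" for f g
        using that(1) not_e[OF that(2)] rel_trans[OF rel_sym[OF j(2)], of g] by auto
    qed (use grid e j Cons.prems(1) in auto)
    also have "\<dots> = joint N (st @ e # es)"
      by (rule joint_mset_cong) (simp only: ms, simp)
    finally show ?thesis by simp
  next
    case False
    have "cov N (st ! j) e = 0" if "j < length st" for j
      using that False Cons.prems(1) by (intro cov_eq_0) auto
    then have "wick (cov N) st (e # es) = wick (cov N) (e # st) es" by simp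
    also have "\<dots> = joint N ((e # st) @ es)"
    proof (rule Cons.IH[symmetric])
      show "sorted_wrt (\<lambda>e f. (e, f) \<notin> rel N) (e # st)"
        using Cons.prems(2) False rel_sym[of e _ N] by auto
      show "class_count N f ((e # st) @ es) \<le> 2" if "f \<in> set ((e # st) @ es)" for f
        using Cons.prems(3)[of f] that class_count_mset_cong[of "(e # st) @ es" "st @ e # es"] by simp
    qed (use Cons.prems in auto)
    also have "\<dots> = joint N (st @ e # es)" by (rule joint_mset_cong) simp
    finally show ?thesis by simp
  qed
qed

text \<open>In the moment the lonely factor splits off with mean 0; in the Wick sum it finds no
  partner of nonzero covariance.\<close>

lemma joint_wick_singleton_class:
  assumes "set es \<subseteq> grid N" "e \<in> set es" "class_count N e es = 1"
  shows "joint N es = 0" "wick (cov N) [] es = 0"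
proof -
  obtain es1 es2 where es: "es = es1 @ e # es2" using split_list[OF assms(2)] by blast
  have e: "e \<in> grid N" using assms by blast
  have not_e: "(e, f) \<notin> rel N" if "f \<in> set es1 \<union> set es2" for f
  proof -
    have "filter (\<lambda>f. (e, f) \<in> rel N) (es1 @ es2) = []"
      using assms(3) rel_refl[OF e] by (simp add: class_count_def es)
    then show ?thesis using that by (auto simp: filter_empty_conv)
  qed
  have "joint N es = joint N ([e] @ es1 @ es2)"
    by (rule joint_mset_cong) (simp add: es)
  also have "\<dots> = joint N [e] * joint N (es1 @ es2)"
    using assms(1) not_e by (intro joint_append) (auto simp: es)
  finally show "joint N es = 0" using joint_singleton[OF e] by simp
  show "wick (cov N) [] es = 0"
    unfolding es
  proof (rule wick_eq_0_unpaired)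
    show "cov N f e = 0" if "f \<in> set [] \<union> set es1" for f
      using that not_e[of f] rel_sym[of f e N] assms(1) e by (intro cov_eq_0) (auto simp: es)
    show "cov N e f = 0" if "f \<in> set es2" for f
      using that not_e[of f] assms(1) e by (intro cov_eq_0) (auto simp: es)
  qed
qed

text \<open>By the two preceding lemmas every class must occur at least twice and some class at
  least three times. Counting the positions class by class gives the strict inequality.\<close>

lemma joint_neq_wick_imp:
  assumes es: "set es \<subseteq> grid N" and neq: "joint N es \<noteq> wick (cov N) [] es"
  shows "2 * num_classes N es < length es"
proof -
  let ?cl = "\<lambda>i. rel N `` {es ! i}"
  have fiber: "card {i \<in> {..<length es}. ?cl i = ?cl j} = class_count N (es ! j) es"
    if "j < length es" for j
  proof -
    have "{i \<in> {..<length es}. ?cl i = ?cl j} = {i. i < length es \<and> (es ! j, es ! i) \<in> rel N}"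
    proof -
      have "?cl i = ?cl j \<longleftrightarrow> (es ! j, es ! i) \<in> rel N" if "i < length es" for i
        using rel_class_eq_iff[of "es ! j" N "es ! i"] es nth_mem[OF that] nth_mem[OF \<open>j < length es\<close>]
        by blast
      then show ?thesis by (simp cong: conj_cong)
    qed
    then show ?thesis by (simp add: class_count_def length_filter_conv_card)
  qed
  have ge1: "class_count N e es \<ge> 1" if "e \<in> set es" for e
    using that es rel_refl[of e N] by (auto simp: class_count_def Suc_le_eq filter_empty_conv)
  have ge2: "class_count N e es \<ge> 2" if "e \<in> set es" for e
    using ge1[OF that] joint_wick_singleton_class[OF es that] neq by fastforce
  have "\<exists>e\<in>set es. class_count N e es > 2"
  proof (rule ccontr)
    assume "\<not> (\<exists>e\<in>set es. class_count N e es > 2)"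
    then have "class_count N e es \<le> 2" if "e \<in> set es" for e using that by force
    then show False using joint_eq_wick[of "[]" es N] es neq by simp
  qed
  then obtain e where e: "e \<in> set es" "class_count N e es > 2" by blast
  then obtain j where j: "j < length es" "es ! j = e" by (auto simp: in_set_conv_nth)
  have img: "(\<lambda>e. rel N `` {e}) ` set es = ?cl ` {..<length es}"
    by (auto simp: set_conv_nth)
  have "2 * num_classes N es = (\<Sum>C\<in>?cl ` {..<length es}. 2)"
    by (simp add: num_classes_def img)
  also have "\<dots> < (\<Sum>C\<in>?cl ` {..<length es}. card {i \<in> {..<length es}. ?cl i = C})"
  proof (rule sum_strict_mono_ex1)
    show "\<forall>C\<in>?cl ` {..<length es}. 2 \<le> card {i \<in> {..<length es}. ?cl i = C}"
      using fiber ge2 by auto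
    show "\<exists>C\<in>?cl ` {..<length es}. 2 < card {i \<in> {..<length es}. ?cl i = C}"
      using fiber[OF j(1)] e j by (intro bexI[of _ "?cl j"]) auto
  qed simp
  also have "\<dots> = length es"
    using sum.image_gen[of "{..<length es}" "\<lambda>_. 1 :: nat" ?cl] by simp
  finally show ?thesis .
qed

lemma num_classes_Cons:
  assumes "set (e # es) \<subseteq> grid N"
  shows "num_classes N (e # es) = num_classes N es + (if \<exists>f\<in>set es. (e, f) \<in> rel N then 0 else 1)"
proof -
  have "rel N `` {e} \<in> (\<lambda>e. rel N `` {e}) ` set es \<longleftrightarrow> (\<exists>f\<in>set es. (e, f) \<in> rel N)"
    using assms rel_class_eq_iff[of e N] unfolding image_iff by (metis list.set_intros subset_iff)
  then show ?thesis by (simp add: num_classes_def card_insert_if)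
qed

lemma C2_pair:
  assumes "e \<in> grid N" "v \<in> {1..N}"
  shows "card {u \<in> {1..N}. (e, (v, u)) \<in> rel N} \<le> B"
  using C2[of "fst e" N "snd e" v] assms by (auto simp: grid_def)

text \<open>A new step whose class already occurs in the walk leaves at most \<open>m * B\<close> choices, and
  one opening a new class leaves at most \<open>N\<close>, which is compensated by the weight \<open>1 / N\<close>.\<close>

lemma sum_walks_num_classes:
  assumes "N \<ge> 1"
  shows "(\<Sum>xs\<in>vlists N (Suc m). (1 / real N) ^ num_classes N (steps xs)) \<le> real N * real (1 + m * B) ^ m"
proof (induction m)
  case 0
  then show ?case by (simp add: sum_vlists_Suc num_classes_def)
next
  case (Suc m)
  have step: "(\<Sum>u\<in>{1..N}. (1 / real N) ^ num_classes N (steps (u # xs)))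
      \<le> (1 / real N) ^ num_classes N (steps xs) * real (1 + Suc m * B)"
    if xs: "xs \<in> vlists N (Suc m)" for xs
  proof -
    obtain v ys where v: "xs = v # ys" using xs by (cases xs) (auto simp: vlists_def)
    have grid: "set (steps xs) \<subseteq> grid N" and v': "v \<in> {1..N}"
      using xs set_steps[of xs] by (auto simp: v vlists_def grid_def)
    let ?old = "\<lambda>u. \<exists>f\<in>set (steps xs). ((u, v), f) \<in> rel N"
    \<comment> \<open>The walk is extended at its front, so the new step \<open>(u, v)\<close> has
      its known vertex in second place. \<open>rel_swap\<close> reverses it into the form that
      \<open>C2\<close> counts.\<close>
    have "{u \<in> {1..N}. ?old u} \<subseteq> (\<Union>f\<in>set (steps xs). {u \<in> {1..N}. (f, (v, u)) \<in> rel N})"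
    proof
      fix u assume "u \<in> {u \<in> {1..N}. ?old u}"
      then obtain f where f: "u \<in> {1..N}" "f \<in> set (steps xs)" "((u, v), f) \<in> rel N" by blast
      have "(f, (v, u)) \<in> rel N"
        using rel_trans[OF rel_sym[OF f(3)] rel_swap] f(1) v' by blast
      with f show "u \<in> (\<Union>f\<in>set (steps xs). {u \<in> {1..N}. (f, (v, u)) \<in> rel N})" by blast
    qed
    then have "card {u \<in> {1..N}. ?old u} \<le> card (\<Union>f\<in>set (steps xs). {u \<in> {1..N}. (f, (v, u)) \<in> rel N})"
      by (intro card_mono) auto
    also have "\<dots> \<le> (\<Sum>f\<in>set (steps xs). card {u \<in> {1..N}. (f, (v, u)) \<in> rel N})"
      by (rule card_UN_le) simp
    also have "\<dots> \<le> card (set (steps xs)) * B"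
      using sum_bounded_above[of "set (steps xs)" "\<lambda>f. card {u \<in> {1..N}. (f, (v, u)) \<in> rel N}" B]
        C2_pair[of _ N v] grid v' by (auto simp: subset_iff)
    also have "\<dots> \<le> Suc m * B"
      using card_length[of "steps xs"] xs by (intro mult_right_mono) (auto simp: vlists_def)
    finally have old: "card {u \<in> {1..N}. ?old u} \<le> Suc m * B" .
    have "(1 / real N) ^ num_classes N (steps (u # xs)) =
        (1 / real N) ^ num_classes N (steps xs) * (if ?old u then 1 else 1 / real N)" if "u \<in> {1..N}" for u
      using num_classes_Cons[of "(u, v)" "steps xs" N] grid v' that by (auto simp: v grid_def)
    then have "(\<Sum>u\<in>{1..N}. (1 / real N) ^ num_classes N (steps (u # xs))) =
        (1 / real N) ^ num_classes N (steps xs) * (\<Sum>u\<in>{1..N}. if ?old u then 1 else 1 / real N)"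
      by (simp add: sum_distrib_left)
    also have "(\<Sum>u\<in>{1..N}. if ?old u then 1 else 1 / real N) \<le> (\<Sum>u\<in>{1..N}. of_bool (?old u) + 1 / real N)"
      by (intro sum_mono) auto
    also have "\<dots> = 1 + real (card {u \<in> {1..N}. ?old u})"
      using assms by (simp add: sum.distrib of_bool_def sum.If_cases Int_def)
    also have "\<dots> \<le> real (1 + Suc m * B)"
      unfolding of_nat_add of_nat_1 using old by (intro add_left_mono) (simp only: of_nat_le_iff)
    finally show ?thesis by (simp add: mult_left_mono)
  qed
  have "(\<Sum>xs\<in>vlists N (Suc (Suc m)). (1 / real N) ^ num_classes N (steps xs)) =
      (\<Sum>xs\<in>vlists N (Suc m). \<Sum>u\<in>{1..N}. (1 / real N) ^ num_classes N (steps (u # xs)))"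
    by (subst sum_vlists_Suc, rule sum.swap)
  also have "\<dots> \<le> (\<Sum>xs\<in>vlists N (Suc m). (1 / real N) ^ num_classes N (steps xs) * real (1 + Suc m * B))"
    by (rule sum_mono) (rule step)
  also have "\<dots> \<le> (real N * real (1 + m * B) ^ m) * real (1 + Suc m * B)"
    unfolding sum_distrib_right[symmetric] by (intro mult_right_mono Suc.IH) simp
  also have "\<dots> \<le> (real N * real (1 + Suc m * B) ^ m) * real (1 + Suc m * B)"
    by (intro mult_right_mono mult_left_mono power_mono) auto
  finally show ?case by (simp add: mult_ac)
qed

text \<open>A walk on which the two sides differ meets c classes with 2 c + 1 \<le> k, so N^(-c) is
  at least N^(-(k-1)/2). As \<open>sum_walks_num_classes\<close> bounds the sum of all N^(-c) by a
  multiple of N, there are O(N^((k+1)/2)) such walks. The normalised trace only sees contributions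
  of order N * N^(k/2).\<close>

lemma sum_walks_joint_wick:
  "\<exists>K\<ge>0. \<forall>N\<ge>1. (\<Sum>xs\<in>vlists N (Suc k). \<bar>joint N (steps xs) - wick (cov N) [] (steps xs)\<bar>)
     \<le> K * sqrt (real N) ^ (k + 1)"
proof -
  \<comment> \<open>The summands come from \<open>joint_bound\<close> and from
    \<open>wick_bound\<close> with an empty stack, both for \<open>k\<close> steps.\<close>
  define K0 where "K0 = 1 + real k * \<bar>R k\<bar> + real (1 + k) ^ k"
  have K0: "K0 \<ge> 0" by (simp add: K0_def)
  have "(\<Sum>xs\<in>vlists N (Suc k). \<bar>joint N (steps xs) - wick (cov N) [] (steps xs)\<bar>)
     \<le> K0 * real (1 + k * B) ^ k * sqrt (real N) ^ (k + 1)" if N: "N \<ge> 1" for N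
  proof -
    let ?s = "sqrt (real N)"
    have s: "?s \<ge> 1" "?s * ?s = real N" using N by auto
    have "\<bar>joint N (steps xs) - wick (cov N) [] (steps xs)\<bar>
        \<le> K0 * (?s ^ k / ?s) * (1 / real N) ^ num_classes N (steps xs)"
      if xs: "xs \<in> vlists N (Suc k)" for xs
    proof (cases "joint N (steps xs) = wick (cov N) [] (steps xs)")
      case True
      then show ?thesis using K0 s by simp
    next
      case False
      have grid: "set (steps xs) \<subseteq> grid N" and len: "length (steps xs) = k"
        using xs set_steps[of xs] by (auto simp: vlists_def grid_def)
      have nc: "2 * num_classes N (steps xs) + 1 \<le> k"
        using joint_neq_wick_imp[OF grid False] len by simp
      have "?s ^ (2 * num_classes N (steps xs) + 1) \<le> ?s ^ k"
        using nc s by (intro power_increasing) auto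
      moreover have "?s ^ (2 * num_classes N (steps xs) + 1) = real N ^ num_classes N (steps xs) * ?s"
        by (simp add: power_mult power2_eq_square)
      ultimately have "1 \<le> (?s ^ k / ?s) * (1 / real N) ^ num_classes N (steps xs)"
        using s N by (simp add: power_one_over pos_le_divide_eq mult.commute)
      then have "K0 * 1 \<le> K0 * ((?s ^ k / ?s) * (1 / real N) ^ num_classes N (steps xs))"
        by (rule mult_left_mono[OF _ K0])
      moreover have "\<bar>wick (cov N) [] (steps xs)\<bar> \<le> real (1 + k) ^ k"
        using wick_bound[of "grid N" "cov N" "[]" "steps xs"] abs_cov_le_1 grid len by simp
      moreover have "\<bar>joint N (steps xs)\<bar> \<le> 1 + real k * \<bar>R k\<bar>"
        using joint_bound[OF grid] len by simp
      ultimately show ?thesis unfolding K0_def by (simp add: mult.assoc)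
    qed
    then have "(\<Sum>xs\<in>vlists N (Suc k). \<bar>joint N (steps xs) - wick (cov N) [] (steps xs)\<bar>)
       \<le> (\<Sum>xs\<in>vlists N (Suc k). K0 * (?s ^ k / ?s) * (1 / real N) ^ num_classes N (steps xs))"
      by (rule sum_mono)
    also have "\<dots> \<le> K0 * (?s ^ k / ?s) * (real N * real (1 + k * B) ^ k)"
      unfolding sum_distrib_left[symmetric]
      using K0 s by (intro mult_left_mono sum_walks_num_classes[OF N]) auto
    also have "\<dots> = K0 * real (1 + k * B) ^ k * ?s ^ (k + 1)"
    proof -
      have "x ^ k / x * y = x ^ (k + 1)" if "x * x = y" "x \<ge> 1" for x y :: real
        using that by auto
      from this[OF s(2,1)] show ?thesis by (metis (no_types, lifting) mult.assoc mult.commute)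
    qed
    finally show ?thesis .
  qed
  moreover have "K0 * real (1 + k * B) ^ k \<ge> 0" using K0 by simp
  ultimately show ?thesis by blast
qed

end

section \<open>Trace moments as Wick sums\<close>

lemma mpow_eq_sum_walks:
  "mpow N A m v r =
     (\<Sum>xs\<in>vlists N m. of_bool (last (v # xs) = r) * (\<Prod>(p, q)\<leftarrow>steps (v # xs). A p q))"
proof (induction m arbitrary: v)
  case (Suc m)
  show ?case
    unfolding mpow.simps mmult_def Suc sum_vlists_Suc sum_distrib_left
    by (intro sum.cong refl) (simp add: mult_ac)
qed simp

text \<open>Up to the reduction to trees only the order N^(-1/2) of the weights matters; the
  variance profile enters later, through the row sums.\<close>

locale weighted_ensemble = correlated_ensemble +
  fixes a :: "nat \<Rightarrow> nat \<Rightarrow> nat \<Rightarrow> real" and b :: real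
  assumes weight_bound: "\<And>N i j. i \<in> {1..N} \<Longrightarrow> j \<in> {1..N} \<Longrightarrow> \<bar>a N i j\<bar> \<le> b / sqrt (real N)"
    and bound_nonneg: "0 \<le> b"
begin

definition trace_moment :: "nat \<Rightarrow> nat \<Rightarrow> real" where
  "trace_moment k N =
     expectation (\<lambda>\<omega>. mtrace N (mpow N (\<lambda>i j. a N i j * X N i j \<omega>) k)) / real N"

abbreviation weight :: "nat \<Rightarrow> nat list \<Rightarrow> real" where
  "weight N xs \<equiv> \<Prod>(p, q)\<leftarrow>steps xs. a N p q"

text \<open>The summation over the next vertex is moved inside the Wick recursion, so that induction
  on the number of remaining steps becomes possible for a given stack. \<open>wick_sum_eq\<close> is
  the link to walks.\<close>

primrec wick_sum :: "nat \<Rightarrow> nat \<Rightarrow> nat \<Rightarrow> (nat \<times> nat) list \<Rightarrow> nat \<Rightarrow> real" where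
  "wick_sum N r 0 = (\<lambda>st v. if st = [] \<and> v = r then 1 else 0)"
| "wick_sum N r (Suc m) = (\<lambda>st v. \<Sum>u\<in>{1..N}. a N v u * (wick_sum N r m ((v, u) # st) u
      + (\<Sum>j<length st. cov N (st ! j) (v, u) * wick_sum N r m (del_nth j st) u)))"

lemma wick_sum_eq:
  "wick_sum N r m st v = (\<Sum>xs\<in>vlists N m. of_bool (last (v # xs) = r) *
     (weight N (v # xs) * wick (cov N) st (steps (v # xs))))"
proof (induction m arbitrary: st v)
  case (Suc m)
  have "(\<Sum>xs\<in>vlists N m. of_bool (last (v # u # xs) = r) *
      (weight N (v # u # xs) * wick (cov N) st (steps (v # u # xs)))) =
    a N v u * (wick_sum N r m ((v, u) # st) u
      + (\<Sum>j<length st. cov N (st ! j) (v, u) * wick_sum N r m (del_nth j st) u))" for u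
    unfolding Suc sum_distrib_left sum.swap[of _ "vlists N m" "{..<length st}"]
      sum.distrib[symmetric]
    by (rule sum.cong) (simp_all add: sum_distrib_left algebra_simps)
  then show ?case by (simp only: wick_sum.simps sum_vlists_Suc)
qed simp

lemma abs_weight_le:
  assumes "set xs \<subseteq> {1..N}"
  shows "\<bar>weight N xs\<bar> \<le> (b / sqrt (real N)) ^ (length xs - 1)"
  using assms
proof (induction xs rule: steps.induct)
  case (1 v u xs)
  have "\<bar>a N v u\<bar> * \<bar>weight N (u # xs)\<bar> \<le> b / sqrt (real N) * (b / sqrt (real N)) ^ (length (u # xs) - 1)"
    using 1 weight_bound[of v N u] bound_nonneg by (intro mult_mono) auto
  then show ?case by (simp add: abs_mult)
qed auto

lemma prod_list_weight_entry:
  "(\<Prod>(p, q)\<leftarrow>es. a N p q * X N p q \<omega>) = (\<Prod>(p, q)\<leftarrow>es. a N p q) * (\<Prod>e\<leftarrow>es. entry N e \<omega>)"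
  by (induction es) (auto simp: entry_def)

lemma trace_moment_eq:
  "trace_moment k N = (\<Sum>v\<in>{1..N}. \<Sum>xs\<in>vlists N k. of_bool (last (v # xs) = v) *
     (weight N (v # xs) * joint N (steps (v # xs)))) / real N"
proof -
  let ?F = "\<lambda>v xs \<omega>. of_bool (last (v # xs) = v) * (weight N (v # xs) * (\<Prod>e\<leftarrow>steps (v # xs). entry N e \<omega>))"
  have int: "integrable M (?F v xs)" if "v \<in> {1..N}" "xs \<in> vlists N k" for v xs
    using that set_steps[of "v # xs"]
    by (intro integrable_mult_right integrable_prod_entry) (auto simp: vlists_def grid_def)
  have "expectation (\<lambda>\<omega>. mtrace N (mpow N (\<lambda>i j. a N i j * X N i j \<omega>) k)) =
    expectation (\<lambda>\<omega>. \<Sum>v\<in>{1..N}. \<Sum>xs\<in>vlists N k. ?F v xs \<omega>)"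
    unfolding mtrace_def mpow_eq_sum_walks prod_list_weight_entry ..
  also have "\<dots> = (\<Sum>v\<in>{1..N}. expectation (\<lambda>\<omega>. \<Sum>xs\<in>vlists N k. ?F v xs \<omega>))"
    by (intro Bochner_Integration.integral_sum Bochner_Integration.integrable_sum int)
  also have "\<dots> = (\<Sum>v\<in>{1..N}. \<Sum>xs\<in>vlists N k. expectation (?F v xs))"
    by (intro sum.cong refl Bochner_Integration.integral_sum int)
  also have "\<dots> = (\<Sum>v\<in>{1..N}. \<Sum>xs\<in>vlists N k. of_bool (last (v # xs) = v) *
      (weight N (v # xs) * joint N (steps (v # xs))))"
    by (simp only: joint_def integral_mult_right_zero)
  finally show ?thesis by (simp add: trace_moment_def)
qed

text \<open>The k weights give N^(-k/2) and the trace is divided by N, against the N^((k+1)/2) of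
  \<open>sum_walks_joint_wick\<close>; a factor N^(-1/2) remains.\<close>

lemma trace_moment_wick_sum:
  "(\<lambda>N. trace_moment k N - (\<Sum>v\<in>{1..N}. wick_sum N v k [] v) / real N) \<longlonglongrightarrow> 0"
proof -
  obtain K where K: "K \<ge> 0" "\<And>N. N \<ge> 1 \<Longrightarrow>
      (\<Sum>xs\<in>vlists N (Suc k). \<bar>joint N (steps xs) - wick (cov N) [] (steps xs)\<bar>)
        \<le> K * sqrt (real N) ^ (k + 1)"
    using sum_walks_joint_wick[of k] by blast
  have bound: "\<bar>trace_moment k N - (\<Sum>v\<in>{1..N}. wick_sum N v k [] v) / real N\<bar>
      \<le> b ^ k * K * (1 / sqrt (real N))" if N: "N \<ge> 1" for N
  proof -
    let ?\<delta> = "\<lambda>xs. joint N (steps xs) - wick (cov N) [] (steps xs)"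
    let ?s = "sqrt (real N)"
    have s: "?s * ?s = real N" "?s > 0" using N by auto
    have "\<bar>trace_moment k N - (\<Sum>v\<in>{1..N}. wick_sum N v k [] v) / real N\<bar> =
        \<bar>\<Sum>v\<in>{1..N}. \<Sum>xs\<in>vlists N k. of_bool (last (v # xs) = v) * (weight N (v # xs) * ?\<delta> (v # xs))\<bar> / real N"
      unfolding trace_moment_eq wick_sum_eq diff_divide_distrib[symmetric] sum_subtractf[symmetric]
        right_diff_distrib[symmetric] by simp
    also have "\<dots> \<le> (\<Sum>v\<in>{1..N}. \<Sum>xs\<in>vlists N k. (b / ?s) ^ k * \<bar>?\<delta> (v # xs)\<bar>) / real N"
    proof (intro divide_right_mono sum_abs[THEN order_trans] sum_mono)
      fix v xs assume "v \<in> {1..N}" "xs \<in> vlists N k"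
      then have "\<bar>weight N (v # xs)\<bar> \<le> (b / ?s) ^ k"
        using abs_weight_le[of "v # xs" N] by (auto simp: vlists_def)
      then have "\<bar>weight N (v # xs)\<bar> * \<bar>?\<delta> (v # xs)\<bar> \<le> (b / ?s) ^ k * \<bar>?\<delta> (v # xs)\<bar>"
        by (rule mult_right_mono) simp
      moreover have "0 \<le> (b / ?s) ^ k * \<bar>?\<delta> (v # xs)\<bar>" using bound_nonneg by simp
      ultimately show "\<bar>of_bool (last (v # xs) = v) * (weight N (v # xs) * ?\<delta> (v # xs))\<bar>
          \<le> (b / ?s) ^ k * \<bar>?\<delta> (v # xs)\<bar>"
        unfolding of_bool_def by (simp only: abs_mult split: if_split) simp
    qed simp
    also have "\<dots> = (b / ?s) ^ k * (\<Sum>xs\<in>vlists N (Suc k). \<bar>?\<delta> xs\<bar>) / real N"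
      by (simp only: sum_vlists_Suc sum_distrib_left)
    also have "\<dots> \<le> (b / ?s) ^ k * (K * ?s ^ (k + 1)) / real N"
      using bound_nonneg by (intro divide_right_mono mult_left_mono K(2)[OF N]) auto
    also have "\<dots> = b ^ k * K * (1 / ?s)"
    proof -
      have "(b / s) ^ k * (K * s ^ (k + 1)) / n = b ^ k * K * (1 / s)" if "s * s = n" "s > 0" for s n :: real
        using that by (auto simp: power_divide)
      from this[OF s] show ?thesis .
    qed
    finally show ?thesis .
  qed
  have "(\<lambda>N. b ^ k * K * (1 / sqrt (real N))) \<longlonglongrightarrow> b ^ k * K * 0"
    by (intro tendsto_intros tendsto_divide_0[OF tendsto_const]
        filterlim_at_top_imp_at_infinity filterlim_compose[OF sqrt_at_top filterlim_real_sequentially])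
  then have "(\<lambda>N. b ^ k * K * (1 / sqrt (real N))) \<longlonglongrightarrow> 0" by simp
  then show ?thesis
    by (rule Lim_null_comparison[rotated])
      (rule eventually_mono[OF eventually_ge_at_top[of 1]], simp only: real_norm_def bound)
qed

text \<open>Power counting for arbitrary stacks by means of \<open>C2\<close>. Opening a step gives
  N choices and height h + 1, hence N * N^(-1/2) * N^(-(h+1)/2) = N^(-h/2). Pairing gives at most h
  * B choices and height h - 1, hence N^(-1/2) * N^(-(h-1)/2), which is again N^(-h/2).\<close>

lemma wick_sum_bound:
  "\<exists>K\<ge>0. \<forall>N\<ge>1. \<forall>r st v. length st = h \<longrightarrow> set st \<subseteq> grid N \<longrightarrow> v \<in> {1..N} \<longrightarrow>
     \<bar>wick_sum N r m st v\<bar> \<le> K / sqrt (real N) ^ h"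
proof (induction m arbitrary: h)
  case 0
  show ?case by (rule exI[of _ 1]) auto
next
  case (Suc m)
  obtain K1 where K1: "K1 \<ge> 0" "\<And>N r st v. N \<ge> 1 \<Longrightarrow> length st = Suc h \<Longrightarrow> set st \<subseteq> grid N \<Longrightarrow>
      v \<in> {1..N} \<Longrightarrow> \<bar>wick_sum N r m st v\<bar> \<le> K1 / sqrt (real N) ^ Suc h"
    using Suc[of "Suc h"] by blast
  \<comment> \<open>For \<open>h = 0\<close> the truncated \<open>h - 1\<close> is harmless: there
    is nothing to pair with, and in \<open>?K\<close> this term carries the factor
    \<open>real h\<close>.\<close>
  obtain K2 where K2: "K2 \<ge> 0" "\<And>N r st v. N \<ge> 1 \<Longrightarrow> length st = h - 1 \<Longrightarrow> set st \<subseteq> grid N \<Longrightarrow>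
      v \<in> {1..N} \<Longrightarrow> \<bar>wick_sum N r m st v\<bar> \<le> K2 / sqrt (real N) ^ (h - 1)"
    using Suc[of "h - 1"] by blast
  let ?K = "b * (K1 + real h * real B * K2)"
  have "\<bar>wick_sum N r (Suc m) st v\<bar> \<le> ?K / sqrt (real N) ^ h"
    if N: "N \<ge> 1" and st: "length st = h" "set st \<subseteq> grid N" and v: "v \<in> {1..N}" for N r st v
  proof -
    let ?s = "sqrt (real N)"
    have s: "?s * ?s = real N" "?s > 0" using N by auto
    let ?I = "\<lambda>j u. of_bool ((st ! j, (v, u)) \<in> rel N) :: real"
    have g: "st ! j \<in> grid N" if "j < h" for j using that st by auto
    have summand: "\<bar>a N v u * (wick_sum N r m ((v, u) # st) u
        + (\<Sum>j<length st. cov N (st ! j) (v, u) * wick_sum N r m (del_nth j st) u))\<bar>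
       \<le> (b / ?s) * (K1 / ?s ^ Suc h + (\<Sum>j<h. ?I j u * (K2 / ?s ^ (h - 1))))" if u: "u \<in> {1..N}" for u
    proof -
      have "\<bar>wick_sum N r m ((v, u) # st) u\<bar> \<le> K1 / ?s ^ Suc h"
        using st u v by (intro K1(2)[OF N]) (auto simp: grid_def)
      moreover have "\<bar>cov N (st ! j) (v, u) * wick_sum N r m (del_nth j st) u\<bar>
          \<le> ?I j u * (K2 / ?s ^ (h - 1))" if j: "j < h" for j
      proof (cases "(st ! j, (v, u)) \<in> rel N")
        case True
        have "\<bar>cov N (st ! j) (v, u)\<bar> * \<bar>wick_sum N r m (del_nth j st) u\<bar> \<le> 1 * (K2 / ?s ^ (h - 1))"
          using j st u v g[OF j] set_del_nth[of j st]
          by (intro mult_mono abs_cov_le_1 K2(2)[OF N]) (auto simp: grid_def length_del_nth)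
        then show ?thesis using True by (simp add: abs_mult)
      next
        case False
        then show ?thesis using cov_eq_0[OF g[OF j] _ False] u v by (simp add: grid_def)
      qed
      ultimately have "\<bar>wick_sum N r m ((v, u) # st) u\<bar>
        + (\<Sum>j<length st. \<bar>cov N (st ! j) (v, u) * wick_sum N r m (del_nth j st) u\<bar>)
         \<le> K1 / ?s ^ Suc h + (\<Sum>j<h. ?I j u * (K2 / ?s ^ (h - 1)))"
        unfolding st(1) by (intro add_mono sum_mono) auto
      then have "\<bar>wick_sum N r m ((v, u) # st) u
        + (\<Sum>j<length st. cov N (st ! j) (v, u) * wick_sum N r m (del_nth j st) u)\<bar>
         \<le> K1 / ?s ^ Suc h + (\<Sum>j<h. ?I j u * (K2 / ?s ^ (h - 1)))"
        by (rule order_trans[OF order_trans[OF abs_triangle_ineq add_left_mono[OF sum_abs]]])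
      moreover have "0 \<le> b / ?s" using bound_nonneg by simp
      ultimately show ?thesis
        unfolding abs_mult using weight_bound[OF v u] by (intro mult_mono) auto
    qed
    have "\<bar>wick_sum N r (Suc m) st v\<bar>
        \<le> (\<Sum>u\<in>{1..N}. (b / ?s) * (K1 / ?s ^ Suc h + (\<Sum>j<h. ?I j u * (K2 / ?s ^ (h - 1)))))"
      unfolding wick_sum.simps by (intro sum_abs[THEN order_trans] sum_mono summand)
    also have "\<dots> = (b / ?s) * (real N * (K1 / ?s ^ Suc h)
        + (\<Sum>j<h. real (card {u \<in> {1..N}. (st ! j, (v, u)) \<in> rel N})) * (K2 / ?s ^ (h - 1)))"
    proof -
      have "(\<Sum>u\<in>{1..N}. \<Sum>j<h. ?I j u * (K2 / ?s ^ (h - 1)))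
          = (\<Sum>j<h. real (card {u \<in> {1..N}. (st ! j, (v, u)) \<in> rel N})) * (K2 / ?s ^ (h - 1))"
        unfolding sum_distrib_right by (subst sum.swap)
          (simp add: of_bool_def sum.If_cases Int_def flip: sum_distrib_right sum_divide_distrib)
      then show ?thesis by (simp only: sum_distrib_left[symmetric] sum.distrib) simp
    qed
    also have "\<dots> \<le> (b / ?s) * (real N * (K1 / ?s ^ Suc h) + (real h * real B) * (K2 / ?s ^ (h - 1)))"
    proof -
      have "(\<Sum>j<h. real (card {u \<in> {1..N}. (st ! j, (v, u)) \<in> rel N})) \<le> real h * real B"
        using sum_bounded_above[of "{..<h}" "\<lambda>j. real (card {u \<in> {1..N}. (st ! j, (v, u)) \<in> rel N})" "real B"]
          C2_pair[OF g v] by simp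
      then show ?thesis
        using bound_nonneg K2(1) by (intro mult_left_mono add_left_mono mult_right_mono) auto
    qed
    also have "\<dots> = ?K / ?s ^ h"
    proof (cases h)
      case 0
      have "(b / s) * (n * (K1 / s ^ Suc 0)) = b * K1" if "s * s = n" "s > 0" for s n :: real
        using that by auto
      from this[OF s] show ?thesis using 0 by simp
    next
      case (Suc g)
      have "(b / s) * (n * (K1 / s ^ Suc (Suc g)) + (x * y) * (K2 / s ^ g))
          = b * (K1 + x * y * K2) / s ^ Suc g"
        if "s * s = n" "s > 0" for s n x y :: real
        using that by (auto simp: field_simps)
      from this[OF s] Suc show ?thesis by simp
    qed
    finally show ?thesis .
  qed
  moreover have "?K \<ge> 0" using K1 K2 bound_nonneg by simp
  ultimately show ?case by blast
qed

end

section \<open>Reduction to trees\<close>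

text \<open>The vertices of the stack path are listed with the current one first. Swapping
  neighbours recovers the steps in the direction in which they were walked, the top of the stack in
  front.\<close>

definition back_steps :: "nat list \<Rightarrow> (nat \<times> nat) list" where
  "back_steps vs = zip (tl vs) vs"

lemma back_steps_simps [simp]:
  "back_steps [v] = []"
  "back_steps (u # v # vs) = (v, u) # back_steps (v # vs)"
  by (simp_all add: back_steps_def)

lemma length_back_steps [simp]: "length (back_steps vs) = length vs - 1"
  by (simp add: back_steps_def)

lemma set_back_steps: "set (back_steps vs) \<subseteq> set vs \<times> set vs"
  unfolding back_steps_def using list.set_sel(2)[of vs]
  by (auto dest: set_zip_leftD set_zip_rightD) (metis list.sel(2) list.set_sel(2) set_zip_leftD)

lemma back_steps_nth: "Suc j < length vs \<Longrightarrow> back_steps vs ! j = (vs ! Suc j, vs ! j)"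
  by (simp add: back_steps_def nth_tl)

context weighted_ensemble begin

text \<open>The part of \<open>wick_sum\<close> in which every pairing retraces the top of the
  stack; its covariance is 1 by \<open>cov_swap\<close>. A path of one vertex means an empty stack
  with the walk back at its root, so no endpoint has to be recorded.\<close>

primrec tree_sum :: "nat \<Rightarrow> nat \<Rightarrow> nat list \<Rightarrow> real" where
  "tree_sum N 0 = (\<lambda>vs. if length vs = 1 then 1 else 0)"
| "tree_sum N (Suc m) = (\<lambda>vs. (\<Sum>u\<in>{1..N}. a N (hd vs) u * tree_sum N m (u # vs))
     + (if length vs \<ge> 2 then a N (hd vs) (hd (tl vs)) * tree_sum N m (tl vs) else 0))"

definition path_error :: "nat \<Rightarrow> nat \<Rightarrow> nat list \<Rightarrow> real" where
  "path_error N m vs = \<bar>wick_sum N (last vs) m (back_steps vs) (hd vs) - tree_sum N m vs\<bar>"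

text \<open>Targets \<open>u\<close> whose step may have nonzero covariance with stack entry
  \<open>j\<close> without retracing the top. For \<open>j = 0\<close> they are controlled by
  \<open>C3\<close>, for larger \<open>j\<close> by \<open>C1\<close>.\<close>

definition defects :: "nat \<Rightarrow> nat \<Rightarrow> nat list \<Rightarrow> nat set" where
  "defects N j vs = {u \<in> {1..N}. (back_steps vs ! j, (hd vs, u)) \<in> rel N \<and> (j = 0 \<longrightarrow> u \<noteq> hd (tl vs))}"

text \<open>Only the current vertex, its predecessor and \<open>u\<close> are constrained, and they
  form a triple counted by \<open>C3\<close>; the other \<open>g\<close> vertices are free.\<close>

lemma sum_defects_top:
  "(\<Sum>vs\<in>vlists N (Suc (Suc g)). real (card (defects N 0 vs))) =
     real N ^ g * real (card {(p, q, r). p \<in> {1..N} \<and> q \<in> {1..N} \<and> r \<in> {1..N}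
                      \<and> ((p, q), (q, r)) \<in> rel N \<and> r \<noteq> p})"
proof -
  let ?S = "\<lambda>v w. {u \<in> {1..N}. ((w, v), (v, u)) \<in> rel N \<and> u \<noteq> w}"
  have "{(p, q, r). p \<in> {1..N} \<and> q \<in> {1..N} \<and> r \<in> {1..N} \<and> ((p, q), (q, r)) \<in> rel N \<and> r \<noteq> p}
     = (\<lambda>(q, p, r). (p, q, r)) ` (SIGMA v:{1..N}. SIGMA w:{1..N}. ?S v w)"
    by (auto simp: image_iff)
  moreover have "inj_on (\<lambda>(q, p, r). (p, q, r)) (SIGMA v:{1..N}. SIGMA w:{1..N}. ?S v w)"
    by (auto simp: inj_on_def)
  ultimately have "card {(p, q, r). p \<in> {1..N} \<and> q \<in> {1..N} \<and> r \<in> {1..N} \<and> ((p, q), (q, r)) \<in> rel N \<and> r \<noteq> p}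
      = (\<Sum>v\<in>{1..N}. \<Sum>w\<in>{1..N}. card (?S v w))"
    by (simp add: card_image card_SigmaI)
  moreover have "(\<Sum>vs\<in>vlists N (Suc (Suc g)). real (card (defects N 0 vs))) =
      real N ^ g * (\<Sum>v\<in>{1..N}. \<Sum>w\<in>{1..N}. real (card (?S v w)))"
    by (simp add: sum_vlists_Suc defects_def card_vlists sum_distrib_left)
  ultimately show ?thesis by simp
qed

text \<open>The constraint links \<open>u\<close>, the current vertex and a step
  \<open>(p, q)\<close> below the top. The remaining \<open>g - 1\<close> vertices are free, and
  since \<open>C1\<close> is uniform in \<open>p\<close>, summing over \<open>p\<close> costs one
  more factor \<open>N\<close>.\<close>

lemma sum_defects_below:
  assumes "N \<ge> 1" "i < g"
  shows "(\<Sum>vs\<in>vlists N (Suc (Suc g)). real (card (defects N (Suc i) vs))) \<le>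
     real N ^ g * real (Max ((\<lambda>p. card {(q, r, s). q \<in> {1..N} \<and> r \<in> {1..N} \<and> s \<in> {1..N}
                      \<and> ((p, q), (r, s)) \<in> rel N}) ` {1..N}))"
proof -
  let ?S = "\<lambda>p q v. {u \<in> {1..N}. ((p, q), (v, u)) \<in> rel N}"
  let ?c = "\<lambda>p. card {(q, r, s). q \<in> {1..N} \<and> r \<in> {1..N} \<and> s \<in> {1..N} \<and> ((p, q), (r, s)) \<in> rel N}"
  obtain d where d: "g = Suc (i + d)" using assms(2) less_iff_Suc_add by auto
  have c: "?c p = (\<Sum>q\<in>{1..N}. \<Sum>v\<in>{1..N}. card (?S p q v))" for p
  proof -
    have "{(q, r, s). q \<in> {1..N} \<and> r \<in> {1..N} \<and> s \<in> {1..N} \<and> ((p, q), (r, s)) \<in> rel N}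
        = (SIGMA q:{1..N}. SIGMA v:{1..N}. ?S p q v)" by auto
    then show ?thesis by (simp add: card_SigmaI)
  qed
  have len: "Suc (Suc g) = Suc (i + Suc (Suc d))" using d by simp
  have "defects N (Suc i) (v # xs @ q # p # ys) = ?S p q v" if "xs \<in> vlists N i" for v xs q p ys
    using that by (auto simp: defects_def back_steps_nth vlists_def nth_append)
  then have "(\<Sum>vs\<in>vlists N (Suc (Suc g)). real (card (defects N (Suc i) vs))) =
      (\<Sum>v\<in>{1..N}. \<Sum>xs\<in>vlists N i. \<Sum>q\<in>{1..N}. \<Sum>p\<in>{1..N}. \<Sum>ys\<in>vlists N d. real (card (?S p q v)))"
    unfolding len sum_vlists_Suc sum_vlists_add by simp
  also have "\<dots> = real N ^ (i + d) * (\<Sum>v\<in>{1..N}. \<Sum>q\<in>{1..N}. \<Sum>p\<in>{1..N}. real (card (?S p q v)))"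
    by (simp add: card_vlists power_add sum_distrib_left mult_ac)
  also have "(\<Sum>v\<in>{1..N}. \<Sum>q\<in>{1..N}. \<Sum>p\<in>{1..N}. real (card (?S p q v))) = (\<Sum>p\<in>{1..N}. real (?c p))"
  proof -
    have "(\<Sum>v\<in>{1..N}. \<Sum>q\<in>{1..N}. \<Sum>p\<in>{1..N}. real (card (?S p q v)))
        = (\<Sum>q\<in>{1..N}. \<Sum>v\<in>{1..N}. \<Sum>p\<in>{1..N}. real (card (?S p q v)))" by (rule sum.swap)
    also have "\<dots> = (\<Sum>q\<in>{1..N}. \<Sum>p\<in>{1..N}. \<Sum>v\<in>{1..N}. real (card (?S p q v)))"
      by (intro sum.cong refl sum.swap)
    also have "\<dots> = (\<Sum>p\<in>{1..N}. \<Sum>q\<in>{1..N}. \<Sum>v\<in>{1..N}. real (card (?S p q v)))" by (rule sum.swap)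
    finally show ?thesis unfolding c by simp
  qed
  finally have eq: "(\<Sum>vs\<in>vlists N (Suc (Suc g)). real (card (defects N (Suc i) vs)))
      = real N ^ (i + d) * (\<Sum>p\<in>{1..N}. real (?c p))" .
  have "(\<Sum>p\<in>{1..N}. real (?c p)) \<le> real (card {1..N}) * real (Max (?c ` {1..N}))"
    by (intro sum_bounded_above) simp
  then have "real N ^ (i + d) * (\<Sum>p\<in>{1..N}. real (?c p))
      \<le> real N ^ (i + d) * (real (card {1..N}) * real (Max (?c ` {1..N})))"
    by (rule mult_left_mono) simp
  moreover have "real N ^ (i + d) * (real (card {1..N}) * x) = real N ^ g * x" for x by (simp add: d)
  ultimately show ?thesis unfolding eq by (simp only:)
qed

text \<open>There are \<open>N ^ (g + 2)\<close> paths with \<open>g + 2\<close> vertices, so the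
  quotient is the mean number of defects of a path.\<close>

lemma defects_negligible:
  assumes "j < Suc g"
  shows "(\<lambda>N. (\<Sum>vs\<in>vlists N (Suc (Suc g)). real (card (defects N j vs))) / real N ^ (g + 2)) \<longlonglongrightarrow> 0"
proof -
  have cancel: "real N ^ g * x / real N ^ (g + 2) = x / (real N)\<^sup>2" if "N \<ge> 1" for N x
    using that by (simp add: power_add power2_eq_square)
  show ?thesis
  proof (cases j)
    case 0
    show ?thesis
    proof (rule Lim_transform_eventually[OF C3])
      show "\<forall>\<^sub>F N in sequentially. real (card {(p, q, r). p \<in> {1..N} \<and> q \<in> {1..N} \<and> r \<in> {1..N}
                        \<and> ((p, q), (q, r)) \<in> rel N \<and> r \<noteq> p}) / (real N)^2 =
          (\<Sum>vs\<in>vlists N (Suc (Suc g)). real (card (defects N j vs))) / real N ^ (g + 2)"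
        using eventually_ge_at_top[of 1]
        by eventually_elim (simp only: 0 sum_defects_top cancel)
    qed
  next
    case (Suc i)
    show ?thesis
    proof (rule Lim_null_comparison[OF _ C1])
      show "\<forall>\<^sub>F N in sequentially. norm ((\<Sum>vs\<in>vlists N (Suc (Suc g)). real (card (defects N j vs))) / real N ^ (g + 2))
        \<le> real (Max ((\<lambda>p. card {(q, r, s). q \<in> {1..N} \<and> r \<in> {1..N} \<and> s \<in> {1..N}
                        \<and> ((p, q), (r, s)) \<in> rel N}) ` {1..N})) / (real N)^2"
        using eventually_ge_at_top[of 1]
      proof eventually_elim
        case (elim N)
        let ?D = "\<Sum>vs\<in>vlists N (Suc (Suc g)). real (card (defects N j vs))"
        have "norm (?D / real N ^ (g + 2)) = ?D / real N ^ (g + 2)" by (simp add: sum_nonneg)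
        also have "\<dots> \<le> (real N ^ g * real (Max ((\<lambda>p. card {(q, r, s). q \<in> {1..N} \<and> r \<in> {1..N} \<and> s \<in> {1..N}
                        \<and> ((p, q), (r, s)) \<in> rel N}) ` {1..N}))) / real N ^ (g + 2)"
          using sum_defects_below[OF elim, of i g] assms Suc by (intro divide_right_mono) auto
        finally show ?case unfolding cancel[OF elim] .
      qed
    qed
  qed
qed

text \<open>Opening a step and retracing the top both lead from a path to a path and reproduce
  \<open>path_error\<close>. All other branches occur at defects; there the stack may cease to be a
  path, and the assumed bound on \<open>wick_sum\<close> is used instead.\<close>

lemma path_error_step:
  assumes K: "\<And>st r u. length st = g \<Longrightarrow> set st \<subseteq> grid N \<Longrightarrow> u \<in> {1..N} \<Longrightarrow>
      \<bar>wick_sum N r m st u\<bar> \<le> K / sqrt (real N) ^ g" and "K \<ge> 0"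
    and vs: "v # w # ws \<in> vlists N (Suc (Suc g))"
  shows "path_error N (Suc m) (v # w # ws) \<le>
     b / sqrt (real N) * ((\<Sum>u\<in>{1..N}. path_error N m (u # v # w # ws)) + path_error N m (w # ws)
       + K / sqrt (real N) ^ g * (\<Sum>j<Suc g. real (card (defects N j (v # w # ws)))))"
proof -
  let ?s = "sqrt (real N)" and ?vs = "v # w # ws"
  let ?r = "last ?vs" and ?st = "back_steps ?vs"
  let ?T = "\<lambda>j u. cov N (?st ! j) (v, u) * wick_sum N ?r m (del_nth j ?st) u"
  \<comment> \<open>\<open>?t\<close> is \<open>?T\<close> without the term that retraces the top,
    so it can be nonzero only at defects.\<close>
  let ?t = "\<lambda>j u. if j = 0 \<and> u = w then 0 else ?T j u"
  have v: "v \<in> {1..N}" and w: "w \<in> {1..N}" and ws: "set ws \<subseteq> {1..N}" "length ws = g"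
    using vs by (auto simp: vlists_def)
  have st: "length ?st = Suc g" "set ?st \<subseteq> grid N"
    using set_back_steps[of ?vs] v w ws by (auto simp: grid_def)
  have t: "\<bar>?t j u\<bar> \<le> of_bool (u \<in> defects N j ?vs) * (K / ?s ^ g)"
    if j: "j < Suc g" and u: "u \<in> {1..N}" for j u
  proof -
    have sj: "?st ! j \<in> grid N" using st j nth_mem[of j ?st] by (metis subsetD)
    have uv: "(v, u) \<in> grid N" using u v by (simp add: grid_def)
    consider "j = 0 \<and> u = w" | "(?st ! j, (v, u)) \<notin> rel N" "\<not> (j = 0 \<and> u = w)"
      | "(?st ! j, (v, u)) \<in> rel N" "\<not> (j = 0 \<and> u = w)" by blast
    then show ?thesis
    proof cases
      case 1
      then show ?thesis using \<open>K \<ge> 0\<close> by simp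
    next
      case 2
      then show ?thesis using cov_eq_0[OF sj uv] \<open>K \<ge> 0\<close> by simp
    next
      case 3
      have "\<bar>?T j u\<bar> \<le> 1 * (K / ?s ^ g)"
        unfolding abs_mult using j st u set_del_nth[of j ?st]
        by (intro mult_mono abs_cov_le_1[OF sj uv] K) (auto simp: length_del_nth)
      moreover have "u \<in> defects N j ?vs" using 3 u by (auto simp: defects_def simp del: back_steps_simps)
      moreover have "(j = 0 \<and> u = w) = False" using 3 by simp
      ultimately show ?thesis by (simp only: if_False of_bool_eq simp_thms)
    qed
  qed
  have T: "(\<Sum>j<length ?st. ?T j u) = (if u = w then wick_sum N ?r m (back_steps (w # ws)) w else 0)
      + (\<Sum>j<Suc g. ?t j u)" for u
  proof -
    have "?T 0 w = wick_sum N ?r m (back_steps (w # ws)) w"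
      using cov_swap[OF w v] by simp
    then show ?thesis
      unfolding st(1) sum.lessThan_Suc_shift by simp
  qed
  have "wick_sum N ?r (Suc m) ?st v =
      (\<Sum>u\<in>{1..N}. a N v u * wick_sum N ?r m (back_steps (u # ?vs)) u)
      + (\<Sum>u\<in>{1..N}. if u = w then a N v w * wick_sum N ?r m (back_steps (w # ws)) w else 0)
      + (\<Sum>u\<in>{1..N}. a N v u * (\<Sum>j<Suc g. ?t j u))"
    unfolding wick_sum.simps T sum.distrib[symmetric]
    by (intro sum.cong refl) (simp add: algebra_simps)
  also have "(\<Sum>u\<in>{1..N}. if u = w then a N v w * wick_sum N ?r m (back_steps (w # ws)) w else 0)
      = a N v w * wick_sum N ?r m (back_steps (w # ws)) w"
    using w by (subst sum.delta) auto
  finally have diff: "wick_sum N ?r (Suc m) ?st v - tree_sum N (Suc m) ?vs =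
      (\<Sum>u\<in>{1..N}. a N v u * (wick_sum N ?r m (back_steps (u # ?vs)) u - tree_sum N m (u # ?vs)))
      + a N v w * (wick_sum N ?r m (back_steps (w # ws)) w - tree_sum N m (w # ws))
      + (\<Sum>u\<in>{1..N}. a N v u * (\<Sum>j<Suc g. ?t j u))"
    by (simp add: sum_subtractf right_diff_distrib del: back_steps_simps wick_sum.simps)
  have "path_error N (Suc m) ?vs \<le>
      \<bar>\<Sum>u\<in>{1..N}. a N v u * (wick_sum N ?r m (back_steps (u # ?vs)) u - tree_sum N m (u # ?vs))\<bar>
      + \<bar>a N v w * (wick_sum N ?r m (back_steps (w # ws)) w - tree_sum N m (w # ws))\<bar>
      + \<bar>\<Sum>u\<in>{1..N}. a N v u * (\<Sum>j<Suc g. ?t j u)\<bar>"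
    unfolding path_error_def list.sel diff
    by (rule order_trans[OF abs_triangle_ineq add_right_mono[OF abs_triangle_ineq]])
  also have "\<dots> \<le> (\<Sum>u\<in>{1..N}. b / ?s * path_error N m (u # ?vs)) + b / ?s * path_error N m (w # ws)
      + (\<Sum>u\<in>{1..N}. b / ?s * (\<Sum>j<Suc g. of_bool (u \<in> defects N j ?vs) * (K / ?s ^ g)))"
  proof (intro add_mono sum_abs[THEN order_trans] sum_mono)
    fix u assume u: "u \<in> {1..N}"
    show "\<bar>a N v u * (wick_sum N ?r m (back_steps (u # ?vs)) u - tree_sum N m (u # ?vs))\<bar>
        \<le> b / ?s * path_error N m (u # ?vs)"
    proof -
      have "path_error N m (u # ?vs) = \<bar>wick_sum N ?r m (back_steps (u # ?vs)) u - tree_sum N m (u # ?vs)\<bar>"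
        by (simp add: path_error_def)
      then show ?thesis
        unfolding abs_mult by (metis abs_ge_zero mult_right_mono weight_bound[OF v u])
    qed
    have "\<bar>\<Sum>j<Suc g. ?t j u\<bar> \<le> (\<Sum>j<Suc g. of_bool (u \<in> defects N j ?vs) * (K / ?s ^ g))"
      using t[OF _ u] by (intro sum_abs[THEN order_trans] sum_mono) auto
    moreover have "0 \<le> b / ?s" using bound_nonneg by simp
    ultimately show "\<bar>a N v u * (\<Sum>j<Suc g. ?t j u)\<bar>
        \<le> b / ?s * (\<Sum>j<Suc g. of_bool (u \<in> defects N j ?vs) * (K / ?s ^ g))"
      unfolding abs_mult using weight_bound[OF v u] by (intro mult_mono) auto
  next
    show "\<bar>a N v w * (wick_sum N ?r m (back_steps (w # ws)) w - tree_sum N m (w # ws))\<bar>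
        \<le> b / ?s * path_error N m (w # ws)"
    proof -
      have "path_error N m (w # ws) = \<bar>wick_sum N ?r m (back_steps (w # ws)) w - tree_sum N m (w # ws)\<bar>"
        by (simp add: path_error_def)
      then show ?thesis
        unfolding abs_mult by (metis abs_ge_zero mult_right_mono weight_bound[OF v w])
    qed
  qed
  also have "(\<Sum>u\<in>{1..N}. b / ?s * (\<Sum>j<Suc g. of_bool (u \<in> defects N j ?vs) * (K / ?s ^ g)))
      = b / ?s * (K / ?s ^ g * (\<Sum>j<Suc g. real (card (defects N j ?vs))))"
  proof -
    have card: "real (card (defects N j ?vs)) = (\<Sum>u\<in>{1..N}. of_bool (u \<in> defects N j ?vs))" for j
    proof -
      have "{1..N} \<inter> {u. u \<in> defects N j ?vs} = defects N j ?vs" by (auto simp: defects_def)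
      then show ?thesis by (simp only: of_bool_def sum.If_cases finite_atLeastAtMost) simp
    qed
    have "(\<Sum>j<Suc g. real (card (defects N j ?vs))) = (\<Sum>u\<in>{1..N}. \<Sum>j<Suc g. of_bool (u \<in> defects N j ?vs))"
      unfolding card by (rule sum.swap)
    then show ?thesis by (simp only: sum_distrib_left sum_distrib_right mult_ac)
  qed
  finally show ?thesis by (simp only: sum_distrib_left[symmetric] distrib_left)
qed

text \<open>Reading a step with a stack that is a path, the only partner compatible with \<open>C1\<close> and
  \<open>C3\<close> to leading order is the top of the stack, traversed backwards; the stack is then again a
  path. This is how the crossing pairings disappear.\<close>

lemma path_error_negligible:
  "(\<lambda>N. (\<Sum>vs\<in>vlists N (Suc h). path_error N m vs) / (real N * sqrt (real N) ^ h)) \<longlonglongrightarrow> 0"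
proof (induction m arbitrary: h)
  case 0
  have "path_error N 0 vs = 0" if vs: "vs \<in> vlists N (Suc h)" for N vs
  proof -
    obtain v ws where "vs = v # ws" using vs by (cases vs) (auto simp: vlists_def)
    then show ?thesis by (cases ws) (auto simp: path_error_def)
  qed
  then show ?case by simp
next
  case (Suc m)
  let ?E = "\<lambda>m h N. (\<Sum>vs\<in>vlists N (Suc h). path_error N m vs)"
  \<comment> \<open>There are \<open>N ^ (h + 1)\<close> paths of height \<open>h\<close>, each with
    a Wick sum of order N^(-h/2) by \<open>wick_sum_bound\<close>. The product N * N^(h/2) is the
    natural size of the total.\<close>
  let ?e = "\<lambda>m h N. ?E m h N / (real N * sqrt (real N) ^ h)"
  have nonneg: "0 \<le> path_error N k vs" for N k vs by (simp add: path_error_def)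
  show ?case
  proof (cases h)
    case 0
    have bound: "norm (?e (Suc m) 0 N) \<le> b * ?e m 1 N" if N: "N \<ge> 1" for N
    proof -
      have "path_error N (Suc m) [v] \<le> (\<Sum>u\<in>{1..N}. b / sqrt (real N) * path_error N m [u, v])"
        if v: "v \<in> {1..N}" for v
      proof -
        have "path_error N (Suc m) [v] =
            \<bar>\<Sum>u\<in>{1..N}. a N v u * (wick_sum N v m [(v, u)] u - tree_sum N m [u, v])\<bar>"
          by (simp add: path_error_def right_diff_distrib sum_subtractf)
        also have "\<dots> \<le> (\<Sum>u\<in>{1..N}. b / sqrt (real N) * path_error N m [u, v])"
        proof (intro sum_abs[THEN order_trans] sum_mono)
          fix u assume u: "u \<in> {1..N}"
          show "\<bar>a N v u * (wick_sum N v m [(v, u)] u - tree_sum N m [u, v])\<bar>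
              \<le> b / sqrt (real N) * path_error N m [u, v]"
          proof -
            have "path_error N m [u, v] = \<bar>wick_sum N v m [(v, u)] u - tree_sum N m [u, v]\<bar>"
              by (simp add: path_error_def)
            then show ?thesis
              unfolding abs_mult by (metis abs_ge_zero mult_right_mono weight_bound[OF v u])
          qed
        qed
        finally show ?thesis .
      qed
      then have "?E (Suc m) 0 N \<le> (\<Sum>v\<in>{1..N}. \<Sum>u\<in>{1..N}. b / sqrt (real N) * path_error N m [u, v])"
        by (subst sum_vlists_Suc) (force intro!: sum_mono)
      also have "\<dots> = b / sqrt (real N) * ?E m 1 N"
        by (subst sum.swap) (simp add: sum_vlists_Suc sum_distrib_left)
      finally have "?E (Suc m) 0 N \<le> b / sqrt (real N) * ?E m 1 N" .
      then have "?E (Suc m) 0 N / real N \<le> b / sqrt (real N) * ?E m 1 N / real N"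
        by (rule divide_right_mono) simp
      then show ?thesis using nonneg by (simp add: sum_nonneg mult_ac)
    qed
    have "(\<lambda>N. b * ?e m 1 N) \<longlonglongrightarrow> 0"
      using tendsto_mult_right_zero[OF Suc[of 1], of b] by simp
    then show ?thesis
      unfolding 0 by (rule Lim_null_comparison[rotated])
        (rule eventually_mono[OF eventually_ge_at_top[of 1]], rule bound)
  next
    case (Suc g)
    obtain K where K: "K \<ge> 0" "\<And>N r st v. N \<ge> 1 \<Longrightarrow> length st = g \<Longrightarrow> set st \<subseteq> grid N \<Longrightarrow>
        v \<in> {1..N} \<Longrightarrow> \<bar>wick_sum N r m st v\<bar> \<le> K / sqrt (real N) ^ g"
      using wick_sum_bound[of g m] by blast
    let ?D = "\<lambda>j N. \<Sum>vs\<in>vlists N (Suc (Suc g)). real (card (defects N j vs))"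
    let ?bound = "\<lambda>N. b * ?e m (Suc (Suc g)) N + b * ?e m g N
        + b * K * (\<Sum>j<Suc g. ?D j N / real N ^ (g + 2))"
    have bound: "norm (?e (Suc m) (Suc g) N) \<le> ?bound N" if N: "N \<ge> 1" for N
    proof -
      let ?s = "sqrt (real N)"
      have s: "?s * ?s = real N" "?s > 0" using N by auto
      have "?E (Suc m) (Suc g) N \<le> (\<Sum>v\<in>{1..N}. \<Sum>w\<in>{1..N}. \<Sum>ws\<in>vlists N g.
        b / ?s * ((\<Sum>u\<in>{1..N}. path_error N m (u # v # w # ws)) + path_error N m (w # ws)
         + K / ?s ^ g * (\<Sum>j<Suc g. real (card (defects N j (v # w # ws))))))"
        unfolding sum_vlists_Suc
        by (intro sum_mono path_error_step K(1) K(2)[OF N]) (auto simp: vlists_def)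
      also have "\<dots> = b / ?s * (?E m (Suc (Suc g)) N + real N * ?E m g N + K / ?s ^ g * (\<Sum>j<Suc g. ?D j N))"
      proof -
        have 1: "?E m (Suc (Suc g)) N =
            (\<Sum>v\<in>{1..N}. \<Sum>w\<in>{1..N}. \<Sum>ws\<in>vlists N g. \<Sum>u\<in>{1..N}. path_error N m (u # v # w # ws))"
        proof -
          have "?E m (Suc (Suc g)) N = (\<Sum>u\<in>{1..N}. \<Sum>vs\<in>vlists N (Suc (Suc g)). path_error N m (u # vs))"
            by (rule sum_vlists_Suc)
          also have "\<dots> = (\<Sum>vs\<in>vlists N (Suc (Suc g)). \<Sum>u\<in>{1..N}. path_error N m (u # vs))"
            by (rule sum.swap)
          finally show ?thesis unfolding sum_vlists_Suc .
        qed
        \<comment> \<open>The shortened path has forgotten \<open>v\<close>, hence the factor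
          \<open>real N\<close>.\<close>
        have 2: "real N * ?E m g N = (\<Sum>v\<in>{1..N}. \<Sum>w\<in>{1..N}. \<Sum>ws\<in>vlists N g. path_error N m (w # ws))"
          by (simp add: sum_vlists_Suc)
        have 3: "(\<Sum>j<Suc g. ?D j N) =
            (\<Sum>v\<in>{1..N}. \<Sum>w\<in>{1..N}. \<Sum>ws\<in>vlists N g. \<Sum>j<Suc g. real (card (defects N j (v # w # ws))))"
        proof -
          have "(\<Sum>j<Suc g. ?D j N) = (\<Sum>vs\<in>vlists N (Suc (Suc g)). \<Sum>j<Suc g. real (card (defects N j vs)))"
            by (rule sum.swap)
          then show ?thesis unfolding sum_vlists_Suc .
        qed
        show ?thesis unfolding 1 2 3 by (simp only: sum_distrib_left[symmetric] sum.distrib)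
      qed
      finally have le: "?E (Suc m) (Suc g) N
         \<le> b / ?s * (?E m (Suc (Suc g)) N + real N * ?E m g N + K / ?s ^ g * (\<Sum>j<Suc g. ?D j N))" .
      have alg: "b / s * (x + n * y + K / s ^ g * z) / (n * s ^ Suc g) =
          b * (x / (n * s ^ Suc (Suc g))) + b * (y / (n * s ^ g)) + b * K * (z / n ^ (g + 2))"
        if "s * s = n" "s > 0" for s n x y z :: real
      proof -
        have n: "n ^ (g + 2) = s ^ g * s ^ g * (s * s * s * s)"
          unfolding that(1)[symmetric] by (simp add: power_mult_distrib)
        show ?thesis
          unfolding n unfolding that(1)[symmetric] using that(2) by (simp add: field_simps)
      qed
      have "norm (?e (Suc m) (Suc g) N) = ?E (Suc m) (Suc g) N / (real N * ?s ^ Suc g)"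
        using nonneg by (simp add: sum_nonneg)
      also have "\<dots> \<le> b / ?s * (?E m (Suc (Suc g)) N + real N * ?E m g N + K / ?s ^ g * (\<Sum>j<Suc g. ?D j N))
          / (real N * ?s ^ Suc g)"
        by (rule divide_right_mono[OF le]) simp
      also have "\<dots> = ?bound N"
        unfolding alg[OF s] sum_divide_distrib ..
      finally show ?thesis .
    qed
    have "?bound \<longlonglongrightarrow> b * 0 + b * 0 + b * K * (\<Sum>j<Suc g. 0)"
      by (intro tendsto_intros Suc.IH defects_negligible) simp
    then have "?bound \<longlonglongrightarrow> 0" by simp
    then show ?thesis
      unfolding Suc by (rule Lim_null_comparison[rotated])
        (rule eventually_mono[OF eventually_ge_at_top[of 1]], rule bound)
  qed
qed

lemma trace_moment_tree_sum:
  "(\<lambda>N. trace_moment k N - (\<Sum>v\<in>{1..N}. tree_sum N k [v]) / real N) \<longlonglongrightarrow> 0"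
proof -
  have "(\<lambda>N. (\<Sum>v\<in>{1..N}. wick_sum N v k [] v) / real N - (\<Sum>v\<in>{1..N}. tree_sum N k [v]) / real N) \<longlonglongrightarrow> 0"
  proof (rule Lim_null_comparison[OF _ path_error_negligible[where h = 0 and m = k]], rule always_eventually, rule allI)
    fix N
    show "norm ((\<Sum>v\<in>{1..N}. wick_sum N v k [] v) / real N - (\<Sum>v\<in>{1..N}. tree_sum N k [v]) / real N)
        \<le> (\<Sum>vs\<in>vlists N (Suc 0). path_error N k vs) / (real N * sqrt (real N) ^ 0)"
      unfolding diff_divide_distrib[symmetric] sum_subtractf[symmetric]
      by (auto simp: sum_vlists_Suc path_error_def intro!: divide_right_mono sum_abs)
  qed
  from tendsto_add[OF trace_moment_wick_sum[of k] this] show ?thesis by simp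
qed

end

section \<open>Ballot numbers and the semicircle moments\<close>

text \<open>Counts the courses that the stack height can take: walks with steps +1 and -1 that lead
  from height \<open>h\<close> to 0 in \<open>m\<close> steps and never become negative.\<close>

fun ballot :: "nat \<Rightarrow> nat \<Rightarrow> nat" where
  "ballot h 0 = (if h = 0 then 1 else 0)"
| "ballot h (Suc m) = ballot (Suc h) m + (if h = 0 then 0 else ballot (h - 1) m)"

lemma ballot_eq_0: "m < h \<or> odd (h + m) \<Longrightarrow> ballot h m = 0"
proof (induction m arbitrary: h)
  case (Suc m)
  have "ballot (Suc h) m = 0" using Suc by auto
  moreover have "ballot (h - 1) m = 0" if "h \<noteq> 0" using Suc that by (cases h) auto
  ultimately show ?case by simp
next
  case 0
  then show ?case by (cases h) auto
qed

text \<open>The difference of binomials known from the reflection principle, for \<open>n\<close>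
  upward and \<open>h + n\<close> downward steps. The recursion of \<open>ballot\<close> is Pascal's
  rule in both terms.\<close>

lemma ballot_eq:
  "int (ballot h (h + 2 * n)) = int (h + 2 * n choose n) - (if n = 0 then 0 else int (h + 2 * n choose (n - 1)))"
proof (induction "h + 2 * n" arbitrary: h n)
  case 0
  then show ?case by simp
next
  case (Suc m)
  show ?case
  proof (cases n)
    case 0
    then have "h = Suc m" using Suc by simp
    then show ?thesis using Suc.hyps(1)[of m 0] 0 ballot_eq_0[of m "Suc (Suc m)"] by simp
  next
    case (Suc n')
    have m: "m = Suc h + 2 * n'" using Suc Suc.hyps(2) by simp
    have up: "int (ballot (Suc h) m) = int (m choose n') - (if n' = 0 then 0 else int (m choose (n' - 1)))"
      using Suc.hyps(1)[OF m] unfolding m[symmetric] .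
    have down: "int (if h = 0 then 0 else ballot (h - 1) m) = int (m choose n) - int (m choose n')"
    proof (cases h)
      case 0
      \<comment> \<open>At height 0 no downward step is allowed; correspondingly the two binomials
        cancel, because here \<open>m = n + n'\<close>.\<close>
      then have "m choose n = m choose n'" using m Suc binomial_symmetric[of n m] by simp
      then show ?thesis using 0 by simp
    next
      case (Suc g)
      have m': "m = g + 2 * n" using m Suc \<open>n = Suc n'\<close> by simp
      show ?thesis using Suc.hyps(1)[OF m'] Suc \<open>n = Suc n'\<close> unfolding m'[symmetric] by simp
    qed
    have "int (Suc m choose n') = int (m choose n') + (if n' = 0 then 0 else int (m choose (n' - 1)))"
      by (cases n') simp_all
    moreover have "int (Suc m choose n) = int (m choose n') + int (m choose n)"
      using Suc by simp
    ultimately show ?thesis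
      using up down Suc.hyps(2)[symmetric] Suc by simp
  qed
qed

lemma ballot_0_eq_catalan: "real (ballot 0 k) = (if even k then catalan (k div 2) else 0)"
proof (cases "even k")
  case True
  then obtain n where k: "k = 2 * n" by blast
  have "real (ballot 0 (2 * n)) = catalan n"
  proof (cases n)
    case 0
    then show ?thesis by (simp add: catalan_def)
  next
    case (Suc j)
    have "int (ballot 0 (2 * n)) = int (2 * n choose n) - int (2 * n choose j)"
      using ballot_eq[of 0 n] Suc by simp
    then have b: "real (ballot 0 (2 * n)) = real (2 * n choose n) - real (2 * n choose j)"
      by linarith
    \<comment> \<open>This turns the difference of binomials into (2n choose n) * (1 - n / (n +
      1)).\<close>
    have "Suc j * (Suc (j + Suc j) choose Suc j) = Suc (Suc j) * (Suc (j + Suc j) choose j)"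
      by (rule Suc_times_binomial_add)
    moreover have "Suc (j + Suc j) = 2 * n" using Suc by simp
    ultimately have "n * (2 * n choose n) = Suc n * (2 * n choose j)"
      using Suc by (simp only:)
    then have "real n * real (2 * n choose n) = (real n + 1) * real (2 * n choose j)"
      by (metis of_nat_Suc of_nat_mult add.commute)
    then show ?thesis unfolding b catalan_def by (simp add: field_simps)
  qed
  then show ?thesis using k by simp
next
  case False
  then show ?thesis using ballot_eq_0[of k 0] by simp
qed

section \<open>Tree sums of symmetric weights and their row sums\<close>

locale symmetric_weighted_ensemble = weighted_ensemble +
  assumes weight_sym: "\<And>N i j. a N i j = a N j i"
begin

definition row_sum :: "nat \<Rightarrow> nat \<Rightarrow> real" where
  "row_sum N v = (\<Sum>u\<in>{1..N}. (a N v u)\<^sup>2)"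

text \<open>The weights of the steps on the path were paid when these were opened. What every
  continuation in \<open>tree_sum\<close> still has to pay is their retracing, by symmetry with the
  same weights.\<close>

abbreviation stack_weight :: "nat \<Rightarrow> nat list \<Rightarrow> real" where
  "stack_weight N vs \<equiv> \<Prod>(p, q)\<leftarrow>back_steps vs. a N p q"

lemma abs_stack_weight_le:
  assumes "v # ws \<in> vlists N (Suc h)"
  shows "\<bar>stack_weight N (v # ws)\<bar> \<le> (b / sqrt (real N)) ^ h"
  using assms
proof (induction ws arbitrary: v h)
  case (Cons w ws)
  then obtain g where g: "h = Suc g" "w # ws \<in> vlists N (Suc g)" by (auto simp: vlists_def)
  have "\<bar>a N w v\<bar> * \<bar>stack_weight N (w # ws)\<bar> \<le> b / sqrt (real N) * (b / sqrt (real N)) ^ g"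
    using Cons.IH[OF g(2)] Cons.prems weight_bound[of w N v] bound_nonneg
    by (intro mult_mono) (auto simp: vlists_def)
  then show ?case using g by (simp add: abs_mult)
qed (auto simp: vlists_def)

text \<open>Every course of the stack height contributes the weight of retracing the stack times row
  sums, which are uniformly close to 1. The error is measured on the natural scale N^(-h/2), so
  opening or retracing a step preserves it up to the factor \<open>b\<close>.\<close>

lemma tree_sum_asymp:
  assumes rows: "\<And>\<epsilon>. \<epsilon> > 0 \<Longrightarrow> \<forall>\<^sub>F N in sequentially. \<forall>v\<in>{1..N}. \<bar>row_sum N v - 1\<bar> \<le> \<epsilon>"
    and "\<epsilon> > 0"
  shows "\<forall>\<^sub>F N in sequentially. \<forall>vs\<in>vlists N (Suc h).
     \<bar>tree_sum N m vs - stack_weight N vs * real (ballot h m)\<bar> \<le> \<epsilon> / sqrt (real N) ^ h"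
  using \<open>\<epsilon> > 0\<close>
proof (induction m arbitrary: h \<epsilon>)
  case 0
  have "\<bar>tree_sum N 0 vs - stack_weight N vs * real (ballot h 0)\<bar> \<le> \<epsilon> / sqrt (real N) ^ h"
    if "vs \<in> vlists N (Suc h)" for N vs
  proof -
    from that obtain v where "length vs = Suc h" "h = 0 \<Longrightarrow> vs = [v]"
      by (auto simp: vlists_def length_Suc_conv)
    then show ?thesis using \<open>\<epsilon> > 0\<close> by auto
  qed
  then show ?case by simp
next
  case (Suc m)
  let ?err = "\<lambda>N h vs. \<bar>tree_sum N m vs - stack_weight N vs * real (ballot h m)\<bar>"
  \<comment> \<open>Three errors get a third of \<open>\<epsilon>\<close> each: the induction
    hypothesis after opening and after retracing a step (\<open>\<epsilon>1\<close>), and the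
    deviation of the row sum from 1 (\<open>\<epsilon>2\<close>). The \<open>+ 1\<close> keeps the
    denominators positive.\<close>
  define \<epsilon>1 where "\<epsilon>1 = \<epsilon> / (3 * (b + 1))"
  define c where "c = b ^ h * real (ballot (Suc h) m)"
  define \<epsilon>2 where "\<epsilon>2 = \<epsilon> / (3 * (c + 1))"
  have c: "c \<ge> 0" using bound_nonneg by (simp add: c_def)
  have \<epsilon>1: "\<epsilon>1 > 0" "b * \<epsilon>1 \<le> \<epsilon> / 3" and \<epsilon>2: "\<epsilon>2 > 0" "c * \<epsilon>2 \<le> \<epsilon> / 3"
    using Suc.prems bound_nonneg c by (auto simp: \<epsilon>1_def \<epsilon>2_def field_simps)
  show ?case
    using Suc.IH[OF \<epsilon>1(1), of "Suc h"] Suc.IH[OF \<epsilon>1(1), of "h - 1"] rows[OF \<epsilon>2(1)] eventually_ge_at_top[of 1]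
  proof eventually_elim
    case (elim N)
    let ?s = "sqrt (real N)"
    have s: "?s * ?s = real N" "?s > 0" using \<open>1 \<le> N\<close> by auto
    show ?case
    proof
      fix vs assume vs: "vs \<in> vlists N (Suc h)"
      then obtain v ws where v: "vs = v # ws" by (cases vs) (auto simp: vlists_def)
      have vN: "v \<in> {1..N}" using vs v by (auto simp: vlists_def)
      let ?W = "stack_weight N vs" and ?\<beta> = "real (ballot (Suc h) m)"

      \<comment> \<open>Since \<open>stack_weight N (u # vs)\<close> equals
        \<open>a N v u * ?W\<close>, the leading terms carry squared weights and add up to
        \<open>row_sum N v\<close>.\<close>
      have open_eq: "(\<Sum>u\<in>{1..N}. a N v u * tree_sum N m (u # vs)) - ?W * ?\<beta> =
          (\<Sum>u\<in>{1..N}. a N v u * (tree_sum N m (u # vs) - stack_weight N (u # vs) * ?\<beta>))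
          + ?W * ?\<beta> * (row_sum N v - 1)"
        unfolding row_sum_def v
        by (simp add: right_diff_distrib sum_subtractf sum_distrib_left power2_eq_square mult_ac)
      have 1: "\<bar>\<Sum>u\<in>{1..N}. a N v u * (tree_sum N m (u # vs) - stack_weight N (u # vs) * ?\<beta>)\<bar> \<le> \<epsilon> / 3 / ?s ^ h"
      proof -
        have "\<bar>\<Sum>u\<in>{1..N}. a N v u * (tree_sum N m (u # vs) - stack_weight N (u # vs) * ?\<beta>)\<bar>
            \<le> (\<Sum>u\<in>{1..N}. b / ?s * (\<epsilon>1 / ?s ^ Suc h))"
        proof (intro sum_abs[THEN order_trans] sum_mono)
          fix u assume u: "u \<in> {1..N}"
          then have "u # vs \<in> vlists N (Suc (Suc h))" using vs by (auto simp: vlists_def)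
          with elim(1) have "?err N (Suc h) (u # vs) \<le> \<epsilon>1 / ?s ^ Suc h" by blast
          moreover have "0 \<le> b / ?s" using bound_nonneg by simp
          ultimately show "\<bar>a N v u * (tree_sum N m (u # vs) - stack_weight N (u # vs) * ?\<beta>)\<bar> \<le> b / ?s * (\<epsilon>1 / ?s ^ Suc h)"
            unfolding abs_mult using weight_bound[OF vN u] by (intro mult_mono) auto
        qed
        also have "\<dots> = real N * (b / ?s * (\<epsilon>1 / ?s ^ Suc h))" by simp
        also have "\<dots> = b * \<epsilon>1 / ?s ^ h"
        proof -
          have "n * (b / s * (\<epsilon>1 / s ^ Suc h)) = b * \<epsilon>1 / s ^ h" if "s * s = n" "s > 0" for s n :: real
            using that by auto
          from this[OF s] show ?thesis .
        qed
        also have "\<dots> \<le> \<epsilon> / 3 / ?s ^ h" by (intro divide_right_mono \<epsilon>1) simp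
        finally show ?thesis .
      qed
      have 2: "\<bar>?W * ?\<beta> * (row_sum N v - 1)\<bar> \<le> \<epsilon> / 3 / ?s ^ h"
      proof -
        have "\<bar>?W * ?\<beta> * (row_sum N v - 1)\<bar> \<le> (b / ?s) ^ h * ?\<beta> * \<epsilon>2"
          unfolding abs_mult using elim(3) vN abs_stack_weight_le[of v ws N h] vs v bound_nonneg
          by (intro mult_mono) auto
        also have "\<dots> = c * \<epsilon>2 / ?s ^ h" by (simp add: c_def power_divide)
        also have "\<dots> \<le> \<epsilon> / 3 / ?s ^ h" by (intro divide_right_mono \<epsilon>2) simp
        finally show ?thesis .
      qed
      show "\<bar>tree_sum N (Suc m) vs - ?W * real (ballot h (Suc m))\<bar> \<le> \<epsilon> / ?s ^ h"
      proof (cases h)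
        case 0
        then have "ws = []" using vs v by (auto simp: vlists_def)
        then have "tree_sum N (Suc m) vs - ?W * real (ballot h (Suc m)) =
            (\<Sum>u\<in>{1..N}. a N v u * tree_sum N m (u # vs)) - ?W * ?\<beta>"
          using 0 v by simp
        moreover have "\<epsilon> / ?s ^ h = \<epsilon> / 3 / ?s ^ h + \<epsilon> / 3 / ?s ^ h + \<epsilon> / 3 / ?s ^ h" "0 \<le> \<epsilon> / 3 / ?s ^ h"
          using Suc.prems by simp_all
        ultimately show ?thesis using 1 2 unfolding open_eq by linarith
      next
        case (Suc g)
        then obtain w ws' where w: "ws = w # ws'" "w # ws' \<in> vlists N (Suc g)" "w \<in> {1..N}"
          using vs v by (auto simp: vlists_def length_Suc_conv)
        have 3: "\<bar>a N v w * (tree_sum N m (w # ws') - stack_weight N (w # ws') * real (ballot g m))\<bar> \<le> \<epsilon> / 3 / ?s ^ h"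
        proof -
          have "?err N g (w # ws') \<le> \<epsilon>1 / ?s ^ g" using elim(2) Suc w(2) by auto
          moreover have "0 \<le> b / ?s" using bound_nonneg by simp
          ultimately have "\<bar>a N v w * (tree_sum N m (w # ws') - stack_weight N (w # ws') * real (ballot g m))\<bar>
              \<le> b / ?s * (\<epsilon>1 / ?s ^ g)"
            unfolding abs_mult using weight_bound[OF vN w(3)] by (intro mult_mono) auto
          also have "\<dots> = b * \<epsilon>1 / ?s ^ h" by (simp add: Suc)
          also have "\<dots> \<le> \<epsilon> / 3 / ?s ^ h" by (intro divide_right_mono \<epsilon>1) simp
          finally show ?thesis .
        qed
        have "tree_sum N (Suc m) vs - ?W * real (ballot h (Suc m)) =
            ((\<Sum>u\<in>{1..N}. a N v u * tree_sum N m (u # vs)) - ?W * ?\<beta>)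
            + a N v w * (tree_sum N m (w # ws') - stack_weight N (w # ws') * real (ballot g m))"
          using Suc v w(1) weight_sym[of N v w] by (simp add: algebra_simps)
        moreover have "\<epsilon> / ?s ^ h = \<epsilon> / 3 / ?s ^ h + \<epsilon> / 3 / ?s ^ h + \<epsilon> / 3 / ?s ^ h" by simp
        ultimately show ?thesis using 1 2 3 unfolding open_eq by linarith
      qed
    qed
  qed
qed

lemma trace_moment_catalan:
  assumes rows: "\<And>\<epsilon>. \<epsilon> > 0 \<Longrightarrow> \<forall>\<^sub>F N in sequentially. \<forall>v\<in>{1..N}. \<bar>row_sum N v - 1\<bar> \<le> \<epsilon>"
  shows "trace_moment k \<longlonglongrightarrow> (if even k then catalan (k div 2) else 0)"
proof -
  have "(\<lambda>N. (\<Sum>v\<in>{1..N}. tree_sum N k [v]) / real N) \<longlonglongrightarrow> real (ballot 0 k)"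
  proof (rule tendstoI)
    fix \<epsilon> :: real assume "\<epsilon> > 0"
    then have "\<forall>\<^sub>F N in sequentially. \<forall>vs\<in>vlists N (Suc 0).
        \<bar>tree_sum N k vs - stack_weight N vs * real (ballot 0 k)\<bar> \<le> (\<epsilon> / 2) / sqrt (real N) ^ 0"
      by (intro tree_sum_asymp rows) auto
    then show "\<forall>\<^sub>F N in sequentially. dist ((\<Sum>v\<in>{1..N}. tree_sum N k [v]) / real N) (real (ballot 0 k)) < \<epsilon>"
      using eventually_ge_at_top[of 1]
    proof eventually_elim
      case (elim N)
      have close: "\<bar>tree_sum N k [v] - real (ballot 0 k)\<bar> \<le> \<epsilon> / 2" if "v \<in> {1..N}" for v
        using elim(1)[rule_format, of "[v]"] that by (simp add: vlists_def)
      have "(\<Sum>v\<in>{1..N}. tree_sum N k [v]) / real N - real (ballot 0 k) =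
          (\<Sum>v\<in>{1..N}. tree_sum N k [v] - real (ballot 0 k)) / real N"
        using elim(2) by (simp add: sum_subtractf field_simps)
      also have "\<bar>\<dots>\<bar> \<le> (\<Sum>v\<in>{1..N}. \<epsilon> / 2) / real N"
        unfolding abs_divide abs_of_nat
        by (intro divide_right_mono sum_abs[THEN order_trans] sum_mono close) auto
      also have "\<dots> < \<epsilon>" using elim(2) \<open>\<epsilon> > 0\<close> by simp
      finally show ?case by (simp add: dist_real_def)
    qed
  qed
  from tendsto_add[OF trace_moment_tree_sum[of k] this] show ?thesis
    by (simp add: ballot_0_eq_catalan)
qed

section \<open>The second and fourth moments\<close>

lemma sum_tree_sum_2: "(\<Sum>v\<in>{1..N}. tree_sum N 2 [v]) = (\<Sum>v\<in>{1..N}. row_sum N v)"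
  by (simp add: numeral_2_eq_2 row_sum_def power2_eq_square weight_sym)

text \<open>There are two plane trees with two edges: a chain starting at the root and a cherry at
  the root. Rooting the chain at its middle vertex turns it into the cherry, so both have the same
  sum over all vertices.\<close>

lemma sum_tree_sum_4: "(\<Sum>v\<in>{1..N}. tree_sum N 4 [v]) = 2 * (\<Sum>v\<in>{1..N}. (row_sum N v)\<^sup>2)"
proof -
  have "tree_sum N 4 [v] = (\<Sum>u\<in>{1..N}. (a N v u)\<^sup>2 * row_sum N u) + (row_sum N v)\<^sup>2" for v
  proof -
    have t2: "tree_sum N 2 [v] = row_sum N v"
      by (simp add: numeral_2_eq_2 row_sum_def power2_eq_square weight_sym[of N v])
    have t2': "tree_sum N 2 [w, u, v] = a N w u * a N u v" for w u
      by (simp add: numeral_2_eq_2)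
    have "tree_sum N 4 [v] = (\<Sum>u\<in>{1..N}. a N v u * tree_sum N 3 [u, v])"
      by (simp add: eval_nat_numeral)
    also have "\<dots> = (\<Sum>u\<in>{1..N}. (a N v u)\<^sup>2 * row_sum N u + (a N v u)\<^sup>2 * row_sum N v)"
    proof (rule sum.cong)
      fix u
      have "tree_sum N 3 [u, v] = (\<Sum>w\<in>{1..N}. a N u w * tree_sum N 2 [w, u, v]) + a N u v * tree_sum N 2 [v]"
        by (simp add: numeral_3_eq_3 numeral_2_eq_2)
      also have "\<dots> = a N v u * row_sum N u + a N v u * row_sum N v"
        unfolding t2 t2' weight_sym[of N u v]
        by (simp add: row_sum_def sum_distrib_left power2_eq_square weight_sym[of N _ u] mult_ac)
      finally show "a N v u * tree_sum N 3 [u, v] = (a N v u)\<^sup>2 * row_sum N u + (a N v u)\<^sup>2 * row_sum N v"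
        by (simp add: power2_eq_square algebra_simps)
    qed simp
    also have "\<dots> = (\<Sum>u\<in>{1..N}. (a N v u)\<^sup>2 * row_sum N u) + (row_sum N v)\<^sup>2"
      by (simp only: sum.distrib sum_distrib_right[symmetric] row_sum_def[of N v, symmetric]
          power2_eq_square[of "row_sum N v"])
    finally show ?thesis .
  qed
  moreover have "(\<Sum>v\<in>{1..N}. \<Sum>u\<in>{1..N}. (a N v u)\<^sup>2 * row_sum N u) = (\<Sum>u\<in>{1..N}. (row_sum N u)\<^sup>2)"
  proof -
    have "(\<Sum>v\<in>{1..N}. (a N v u)\<^sup>2) = row_sum N u" for u
      unfolding row_sum_def by (intro sum.cong refl) (simp add: weight_sym)
    then show ?thesis
      by (subst sum.swap) (simp only: sum_distrib_right[symmetric] power2_eq_square[of "row_sum N _"])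
  qed
  ultimately show ?thesis by (simp add: sum.distrib)
qed

text \<open>Expanding the square gives the mean of the squares minus twice the mean plus 1, and the
  two preceding lemmas give the limit 1 - 2 + 1.\<close>

lemma row_sum_variance:
  assumes "trace_moment 2 \<longlonglongrightarrow> 1" "trace_moment 4 \<longlonglongrightarrow> 2"
  shows "(\<lambda>N. (\<Sum>v\<in>{1..N}. (row_sum N v - 1)\<^sup>2) / real N) \<longlonglongrightarrow> 0"
proof -
  have 2: "(\<lambda>N. (\<Sum>v\<in>{1..N}. row_sum N v) / real N) \<longlonglongrightarrow> 1"
    using tendsto_diff[OF assms(1) trace_moment_tree_sum[of 2]] unfolding sum_tree_sum_2 by simp
  have 4: "(\<lambda>N. 2 * (\<Sum>v\<in>{1..N}. (row_sum N v)\<^sup>2) / real N) \<longlonglongrightarrow> 2"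
    using tendsto_diff[OF assms(2) trace_moment_tree_sum[of 4]] unfolding sum_tree_sum_4 by simp
  have "(\<lambda>N. (2 * (\<Sum>v\<in>{1..N}. (row_sum N v)\<^sup>2) / real N) / 2
      - 2 * ((\<Sum>v\<in>{1..N}. row_sum N v) / real N) + 1) \<longlonglongrightarrow> 2 / 2 - 2 * 1 + 1"
    by (intro tendsto_intros 2 4) simp
  then have "(\<lambda>N. (2 * (\<Sum>v\<in>{1..N}. (row_sum N v)\<^sup>2) / real N) / 2
      - 2 * ((\<Sum>v\<in>{1..N}. row_sum N v) / real N) + 1) \<longlonglongrightarrow> 0" by simp
  moreover have "\<forall>\<^sub>F N in sequentially. (2 * (\<Sum>v\<in>{1..N}. (row_sum N v)\<^sup>2) / real N) / 2
      - 2 * ((\<Sum>v\<in>{1..N}. row_sum N v) / real N) + 1 = (\<Sum>v\<in>{1..N}. (row_sum N v - 1)\<^sup>2) / real N"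
    using eventually_ge_at_top[of 1]
  proof eventually_elim
    case (elim N)
    have "(\<Sum>v\<in>{1..N}. (row_sum N v - 1)\<^sup>2) =
        (\<Sum>v\<in>{1..N}. (row_sum N v)\<^sup>2) - 2 * (\<Sum>v\<in>{1..N}. row_sum N v) + real N"
      by (simp add: power2_diff sum.distrib sum_subtractf sum_distrib_left)
    then show ?case using elim by (simp add: field_simps)
  qed
  ultimately show ?thesis by (rule Lim_transform_eventually)
qed

end

section \<open>Riemann sums\<close>

definition cell_tags :: "nat \<Rightarrow> (nat \<Rightarrow> real) \<Rightarrow> bool" where
  "cell_tags N t \<longleftrightarrow> (\<forall>m<N. t m \<in> {real m / real N..real (Suc m) / real N})"

text \<open>Darboux's criterion on uniform partitions, with pairs of tags in place of suprema and
  infima. In this form it passes to squares and controls all partial Riemann sums at once.\<close>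

definition vanishing_oscillation :: "(real \<Rightarrow> real) \<Rightarrow> bool" where
  "vanishing_oscillation f \<longleftrightarrow> (\<forall>\<epsilon>>0. \<forall>\<^sub>F N in sequentially. \<forall>x y. cell_tags N x \<longrightarrow> cell_tags N y \<longrightarrow>
     (\<Sum>m<N. \<bar>f (x m) - f (y m)\<bar>) / real N \<le> \<epsilon>)"

lemma cell_in_unit: "m < N \<Longrightarrow> {real m / real N..real (Suc m) / real N} \<subseteq> {0..1}"
  by (auto simp: field_simps intro: order_trans)

lemma cell_tags_unit: "cell_tags N t \<Longrightarrow> m < N \<Longrightarrow> t m \<in> {0..1}"
  using cell_in_unit[of m N] unfolding cell_tags_def by blast

lemma uniform_tagged_division:
  assumes N: "N \<ge> 1" and t: "cell_tags N t"
  shows "(\<lambda>m. (t m, {real m / real N..real (Suc m) / real N})) ` {..<N} tagged_division_of {0..1}"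
proof (rule tagged_division_ofI)
  let ?c = "\<lambda>m. {real m / real N..real (Suc m) / real N}"
  let ?p = "(\<lambda>m. (t m, ?c m)) ` {..<N}"
  show "finite ?p" by simp
  show "x \<in> K" if "(x, K) \<in> ?p" for x K using that t by (auto simp: cell_tags_def)
  show "K \<subseteq> {0..1}" if "(x, K) \<in> ?p" for x K using that cell_in_unit by blast
  show "\<exists>a b. K = cbox a b" if "(x, K) \<in> ?p" for x K using that by (auto simp: cbox_interval)
  show "interior K1 \<inter> interior K2 = {}"
    if p: "(x1, K1) \<in> ?p" "(x2, K2) \<in> ?p" "(x1, K1) \<noteq> (x2, K2)" for x1 K1 x2 K2
  proof -
    obtain i j where ij: "x1 = t i" "K1 = ?c i" "x2 = t j" "K2 = ?c j" using p(1,2) by auto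
    with p(3) have "i < j \<or> j < i" by (metis linorder_neqE_nat)
    then have "real (Suc i) / real N \<le> real j / real N \<or> real (Suc j) / real N \<le> real i / real N"
      using N by (auto simp: divide_simps)
    then show ?thesis unfolding ij by (auto simp: interior_atLeastAtMost_real)
  qed
  show "\<Union>{K. \<exists>x. (x, K) \<in> ?p} = {0..1}"
  proof
    show "\<Union>{K. \<exists>x. (x, K) \<in> ?p} \<subseteq> {0..1}" using cell_in_unit by blast
    show "{0..1} \<subseteq> \<Union>{K. \<exists>x. (x, K) \<in> ?p}"
    proof
      fix y :: real assume y: "y \<in> {0..1}"
      have "\<exists>m<N. y \<in> ?c m"
      \<comment> \<open>At \<open>y = 1\<close> the floor used below would be \<open>N\<close>,
        which is not the index of a cell.\<close>
      proof (cases "y = 1")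
        case True
        then show ?thesis using N by (intro exI[of _ "N - 1"]) (auto simp: divide_simps)
      next
        case False
        define m where "m = nat \<lfloor>y * real N\<rfloor>"
        have "real m = of_int \<lfloor>y * real N\<rfloor>" using y by (simp add: m_def)
        then have m: "real m \<le> y * real N" "y * real N < real m + 1" by linarith+
        have "y * real N < 1 * real N" using y False N by (intro mult_strict_right_mono) auto
        with m have "m < N" by simp
        then show ?thesis using m N by (intro exI[of _ m]) (auto simp: field_simps)
      qed
      then show "y \<in> \<Union>{K. \<exists>x. (x, K) \<in> ?p}" by blast
    qed
  qed
qed

text \<open>Once the mesh 1/N is below \<open>d\<close>, every Riemann sum on the uniform cells lies
  within \<open>\<epsilon> / 2\<close> of \<open>I\<close>, so any two of them differ by less than
  \<open>\<epsilon>\<close>.\<close>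

lemma vanishing_oscillation_riemann:
  assumes "riemann_integrable_on f 0 1"
  shows "vanishing_oscillation f"
  unfolding vanishing_oscillation_def
proof (intro allI impI)
  fix \<epsilon> :: real assume \<epsilon>: "\<epsilon> > 0"
  obtain I d where d: "d > 0" and I: "\<And>p. p tagged_division_of {0..1} \<Longrightarrow> (\<lambda>x. ball x d) fine p \<Longrightarrow>
      \<bar>(\<Sum>(x, K)\<in>p. Henstock_Kurzweil_Integration.content K * f x) - I\<bar> < \<epsilon> / 2"
    using assms half_gt_zero[OF \<epsilon>] unfolding riemann_integrable_on_def by metis
  have "\<forall>\<^sub>F N in sequentially. 1 / real N < d"
    using order_tendstoD(2)[OF lim_1_over_n d] by simp
  then show "\<forall>\<^sub>F N in sequentially. \<forall>x y. cell_tags N x \<longrightarrow> cell_tags N y \<longrightarrow>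
     (\<Sum>m<N. \<bar>f (x m) - f (y m)\<bar>) / real N \<le> \<epsilon>"
    using eventually_ge_at_top[of 1]
  proof eventually_elim
    case (elim N)
    have S: "\<bar>(\<Sum>m<N. f (t m)) / real N - I\<bar> < \<epsilon> / 2" if t: "cell_tags N t" for t
    proof -
      let ?c = "\<lambda>m. {real m / real N..real (Suc m) / real N}"
      let ?p = "(\<lambda>m. (t m, ?c m)) ` {..<N}"
      have "(\<lambda>x. ball x d) fine ?p"
      proof (rule fineI)
        fix x K assume "(x, K) \<in> ?p"
        then obtain m where m: "m < N" "x = t m" "K = ?c m" by auto
        have "real (Suc m) / real N - real m / real N = 1 / real N" by (simp add: diff_divide_distrib[symmetric])
        then have "\<bar>y - t m\<bar> < d" if "y \<in> ?c m" for y
          using that t m(1) elim(1) unfolding cell_tags_def by fastforce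
        then show "K \<subseteq> ball x d" unfolding m by (auto simp: dist_real_def abs_minus_commute)
      qed
      from I[OF uniform_tagged_division[OF elim(2) t] this]
      have "\<bar>(\<Sum>(x, K)\<in>?p. Henstock_Kurzweil_Integration.content K * f x) - I\<bar> < \<epsilon> / 2" .
      moreover have "inj_on (\<lambda>m. (t m, ?c m)) {..<N}"
        using elim(2) by (auto simp: inj_on_def Icc_eq_Icc divide_simps)
      then have "(\<Sum>(x, K)\<in>?p. Henstock_Kurzweil_Integration.content K * f x) = (\<Sum>m<N. f (t m)) / real N"
        by (subst sum.reindex) (auto simp: sum_divide_distrib diff_divide_distrib[symmetric] divide_right_mono)
      ultimately show ?thesis by simp
    qed
    show ?case
    proof (intro allI impI)
      fix x y assume xy: "cell_tags N x" "cell_tags N y"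
      \<comment> \<open>exchanging tags makes all differences nonnegative\<close>
      define x' where "x' m = (if f (x m) \<ge> f (y m) then x m else y m)" for m
      define y' where "y' m = (if f (x m) \<ge> f (y m) then y m else x m)" for m
      have tags: "cell_tags N x'" "cell_tags N y'" using xy by (auto simp: cell_tags_def x'_def y'_def)
      have "(\<Sum>m<N. \<bar>f (x m) - f (y m)\<bar>) = (\<Sum>m<N. f (x' m)) - (\<Sum>m<N. f (y' m))"
        unfolding sum_subtractf[symmetric] by (intro sum.cong) (auto simp: x'_def y'_def)
      then have "(\<Sum>m<N. \<bar>f (x m) - f (y m)\<bar>) / real N = (\<Sum>m<N. f (x' m)) / real N - (\<Sum>m<N. f (y' m)) / real N"
        by (simp add: diff_divide_distrib)
      then show "(\<Sum>m<N. \<bar>f (x m) - f (y m)\<bar>) / real N \<le> \<epsilon>"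
        using S[OF tags(1)] S[OF tags(2)] by linarith
    qed
  qed
qed

text \<open>Squaring is Lipschitz with constant 2 c on [-c, c].\<close>

lemma vanishing_oscillation_square:
  assumes osc: "vanishing_oscillation f" and bdd: "\<And>x. x \<in> {0..1} \<Longrightarrow> \<bar>f x\<bar> \<le> c"
  shows "vanishing_oscillation (\<lambda>x. (f x)\<^sup>2)"
  unfolding vanishing_oscillation_def
proof (intro allI impI)
  fix \<epsilon> :: real assume \<epsilon>: "\<epsilon> > 0"
  have c: "c \<ge> 0" using bdd[of 0] by force
  define \<delta> where "\<delta> = \<epsilon> / (2 * c + 1)"
  have \<delta>: "\<delta> > 0" "2 * c * \<delta> \<le> \<epsilon>" using \<epsilon> c by (auto simp: \<delta>_def field_simps)
  from osc \<delta>(1) have "\<forall>\<^sub>F N in sequentially. \<forall>x y. cell_tags N x \<longrightarrow> cell_tags N y \<longrightarrow>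
     (\<Sum>m<N. \<bar>f (x m) - f (y m)\<bar>) / real N \<le> \<delta>"
    unfolding vanishing_oscillation_def by blast
  then show "\<forall>\<^sub>F N in sequentially. \<forall>x y. cell_tags N x \<longrightarrow> cell_tags N y \<longrightarrow>
     (\<Sum>m<N. \<bar>(f (x m))\<^sup>2 - (f (y m))\<^sup>2\<bar>) / real N \<le> \<epsilon>"
  proof eventually_elim
    case (elim N)
    show ?case
    proof (intro allI impI)
      fix x y assume xy: "cell_tags N x" "cell_tags N y"
      have "\<bar>(f (x m))\<^sup>2 - (f (y m))\<^sup>2\<bar> \<le> 2 * c * \<bar>f (x m) - f (y m)\<bar>" if "m < N" for m
      proof -
        have "\<bar>(f (x m))\<^sup>2 - (f (y m))\<^sup>2\<bar> = \<bar>f (x m) + f (y m)\<bar> * \<bar>f (x m) - f (y m)\<bar>"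
          by (simp add: power2_eq_square abs_mult[symmetric] algebra_simps)
        also have "\<dots> \<le> 2 * c * \<bar>f (x m) - f (y m)\<bar>"
          using bdd[OF cell_tags_unit[OF xy(1) that]] bdd[OF cell_tags_unit[OF xy(2) that]]
          by (intro mult_right_mono) auto
        finally show ?thesis .
      qed
      then have "(\<Sum>m<N. \<bar>(f (x m))\<^sup>2 - (f (y m))\<^sup>2\<bar>) / real N \<le> (\<Sum>m<N. 2 * c * \<bar>f (x m) - f (y m)\<bar>) / real N"
        by (intro divide_right_mono sum_mono) auto
      also have "\<dots> = 2 * c * ((\<Sum>m<N. \<bar>f (x m) - f (y m)\<bar>) / real N)"
        by (simp add: sum_distrib_left)
      also have "\<dots> \<le> 2 * c * \<delta>" using elim xy c by (intro mult_left_mono) auto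
      also have "\<dots> \<le> \<epsilon>" by (rule \<delta>)
      finally show "(\<Sum>m<N. \<bar>(f (x m))\<^sup>2 - (f (y m))\<^sup>2\<bar>) / real N \<le> \<epsilon>" .
    qed
  qed
qed

lemma vanishing_oscillation_continuous:
  assumes "continuous_on {0..1} f"
  shows "vanishing_oscillation f"
  unfolding vanishing_oscillation_def
proof (intro allI impI)
  fix \<epsilon> :: real assume \<epsilon>: "\<epsilon> > 0"
  have "uniformly_continuous_on {0..1} f"
    using assms by (intro compact_uniformly_continuous) auto
  then obtain d where d: "d > 0" "\<And>x y. x \<in> {0..1} \<Longrightarrow> y \<in> {0..1} \<Longrightarrow> dist y x < d \<Longrightarrow> dist (f y) (f x) < \<epsilon>"
    unfolding uniformly_continuous_on_def using \<epsilon> by meson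
  have "\<forall>\<^sub>F N in sequentially. 1 / real N < d"
    using order_tendstoD(2)[OF lim_1_over_n d(1)] by simp
  then show "\<forall>\<^sub>F N in sequentially. \<forall>x y. cell_tags N x \<longrightarrow> cell_tags N y \<longrightarrow>
     (\<Sum>m<N. \<bar>f (x m) - f (y m)\<bar>) / real N \<le> \<epsilon>"
    using eventually_ge_at_top[of 1]
  proof eventually_elim
    case (elim N)
    show ?case
    proof (intro allI impI)
      fix x y assume xy: "cell_tags N x" "cell_tags N y"
      have "\<bar>f (x m) - f (y m)\<bar> \<le> \<epsilon>" if m: "m < N" for m
      proof -
        have "real (Suc m) / real N - real m / real N = 1 / real N" by (simp add: diff_divide_distrib[symmetric])
        then have "dist (x m) (y m) < d"
          using xy m elim(1) unfolding cell_tags_def dist_real_def by fastforce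
        from d(2)[OF _ _ this] show ?thesis
          using cell_tags_unit[OF xy(1) m] cell_tags_unit[OF xy(2) m] by (simp add: dist_real_def)
      qed
      then have "(\<Sum>m<N. \<bar>f (x m) - f (y m)\<bar>) / real N \<le> (\<Sum>m<N. \<epsilon>) / real N"
        by (intro divide_right_mono sum_mono) auto
      also have "\<dots> = \<epsilon>" using elim(2) by simp
      finally show "(\<Sum>m<N. \<bar>f (x m) - f (y m)\<bar>) / real N \<le> \<epsilon>" .
    qed
  qed
qed

section \<open>Gauge integrals and uniform Riemann sums\<close>

lemma riemann_integrable_on_imp_integrable_on:
  assumes "riemann_integrable_on f a b"
  shows "f integrable_on {a..b}"
proof -
  from assms obtain I where I: "\<And>e. e > 0 \<Longrightarrow> \<exists>d>0. \<forall>p. p tagged_division_of {a..b} \<and> (\<lambda>x. ball x d) fine p \<longrightarrow>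
      \<bar>(\<Sum>(x,K)\<in>p. Henstock_Kurzweil_Integration.content K * f x) - I\<bar> < e"
    unfolding riemann_integrable_on_def by blast
  have "(f has_integral I) (cbox a b)"
    unfolding has_integral
  proof (intro allI impI)
    fix e :: real assume "e > 0"
    then obtain d where d: "d > 0" "\<And>p. p tagged_division_of {a..b} \<Longrightarrow> (\<lambda>x. ball x d) fine p \<Longrightarrow>
      \<bar>(\<Sum>(x,K)\<in>p. Henstock_Kurzweil_Integration.content K * f x) - I\<bar> < e" using I by meson
    show "\<exists>\<gamma>. gauge \<gamma> \<and> (\<forall>\<D>. \<D> tagged_division_of cbox a b \<and> \<gamma> fine \<D> \<longrightarrow>
        norm ((\<Sum>(x,K)\<in>\<D>. Henstock_Kurzweil_Integration.content K *\<^sub>R f x) - I) < e)"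
      using d by (intro exI[of _ "\<lambda>x. ball x d"]) (auto simp: gauge_ball)
  qed
  then show ?thesis by (auto simp: integrable_on_def)
qed

text \<open>Squares of gauge integrable functions need not be integrable; boundedness allows a
  comparison of the measurable square with a constant.\<close>

lemma integrable_on_square_bounded:
  fixes f :: "real \<Rightarrow> real"
  assumes "f integrable_on {a..b}" and "\<And>x. x \<in> {a..b} \<Longrightarrow> \<bar>f x\<bar> \<le> c"
  shows "(\<lambda>x. (f x)\<^sup>2) integrable_on {a..b}"
proof -
  have m: "f \<in> borel_measurable (lebesgue_on {a..b})"
    using assms(1) by (rule integrable_imp_measurable)
  show ?thesis
  proof (rule measurable_bounded_by_integrable_imp_integrable)
    show "(\<lambda>x. (f x)\<^sup>2) \<in> borel_measurable (lebesgue_on {a..b})"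
      using m by simp
    show "(\<lambda>x. c\<^sup>2) integrable_on {a..b}" by (rule integrable_const_ivl)
    show "norm ((f x)\<^sup>2) \<le> c\<^sup>2" if "x \<in> {a..b}" for x
      using assms(2)[OF that] by (simp add: abs_le_square_iff[symmetric])
  qed simp
qed

text \<open>The uniformity in \<open>n\<close> is the point: in \<open>riemann_sum_phi\<close> the
  upper limits depend on the row \<open>v\<close>, and the estimate must hold for all rows
  simultaneously.\<close>

lemma riemann_sum_uniform:
  assumes int: "g integrable_on {0..1}" and osc: "vanishing_oscillation g" and \<epsilon>: "\<epsilon> > 0"
  shows "\<forall>\<^sub>F N in sequentially. \<forall>t. cell_tags N t \<longrightarrow> (\<forall>n\<le>N.
    \<bar>(\<Sum>m<n. g (t m)) / real N - integral {0..real n / real N} g\<bar> \<le> \<epsilon>)"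
proof -
  from osc half_gt_zero[OF \<epsilon>] have "\<forall>\<^sub>F N in sequentially. \<forall>x y. cell_tags N x \<longrightarrow> cell_tags N y \<longrightarrow>
     (\<Sum>m<N. \<bar>g (x m) - g (y m)\<bar>) / real N \<le> \<epsilon> / 2"
    unfolding vanishing_oscillation_def by blast
  then show ?thesis
    using eventually_ge_at_top[of 1]
  proof eventually_elim
    case (elim N)
    let ?c = "\<lambda>m. {real m / real N..real (Suc m) / real N}"
    have len: "real (Suc m) / real N - real m / real N = 1 / real N" for m
      by (simp add: diff_divide_distrib[symmetric])
    have le: "real m / real N \<le> real (Suc m) / real N" for m by (simp add: divide_right_mono)
    have intc: "g integrable_on ?c m" if "m < N" for m
      using integrable_on_subinterval[OF int cell_in_unit[OF that]] by simp
    show ?case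
    proof (intro allI impI)
      fix t n assume t: "cell_tags N t" and n: "n \<le> N"
      have split: "integral {0..real n / real N} g = (\<Sum>m<n. integral (?c m) g)"
        using n
      proof (induction n)
        case (Suc n)
        have "{0..real (Suc n) / real N} \<subseteq> {0..1}" using Suc.prems by (auto simp: divide_simps)
        then have "g integrable_on {0..real (Suc n) / real N}"
          using integrable_on_subinterval[OF int] by simp
        then have "integral {0..real n / real N} g + integral (?c n) g = integral {0..real (Suc n) / real N} g"
          using le[of n] by (intro Henstock_Kurzweil_Integration.integral_combine) auto
        then show ?case using Suc by simp
      qed simp
      \<comment> \<open>The value at \<open>y\<close> is almost as far from that at the tag as the
        cell permits; \<open>\<epsilon> / 2\<close> makes up for a supremum that need not be
        attained. Without such a \<open>y\<close> the integrand \<open>g y - g (t m)\<close> would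
        be too small everywhere for its integral.\<close>
      have "\<exists>y. y \<in> ?c m \<and> \<bar>integral (?c m) g - g (t m) / real N\<bar> \<le> (\<bar>g (t m) - g y\<bar> + \<epsilon> / 2) / real N"
        if m: "m < N" for m
      proof (rule ccontr)
        let ?J = "integral (?c m) g - g (t m) / real N"
        assume none: "\<not> ?thesis"
        have far: "\<bar>g (t m) - g y\<bar> + \<epsilon> / 2 < \<bar>?J\<bar> * real N" if "y \<in> ?c m" for y
        proof -
          have "(\<bar>g (t m) - g y\<bar> + \<epsilon> / 2) / real N < \<bar>?J\<bar>" using none that by (meson not_le)
          then show ?thesis using elim(2) by (simp add: pos_divide_less_eq)
        qed
        have "((\<lambda>y. g y - g (t m)) has_integral (integral (?c m) g - g (t m) * (1 / real N))) (?c m)"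
          using has_integral_diff[OF integrable_integral[OF intc[OF m]] has_integral_const_real[of "g (t m)" "real m / real N" "real (Suc m) / real N"]]
            le[of m] len[of m] by (simp add: mult.commute)
        then have "norm (integral (?c m) g - g (t m) * (1 / real N))
            \<le> (\<bar>?J\<bar> * real N - \<epsilon> / 2) * Henstock_Kurzweil_Integration.content (?c m)"
        proof (rule has_integral_bound_real[rotated 2])
          show "0 \<le> \<bar>?J\<bar> * real N - \<epsilon> / 2"
            using far[of "t m"] t m by (auto simp: cell_tags_def)
          show "finite ({} :: real set)" by simp
          show "norm (g y - g (t m)) \<le> \<bar>?J\<bar> * real N - \<epsilon> / 2" if "y \<in> ?c m - {}" for y
            using far[of y] that by (auto simp: abs_minus_commute)
        qed
        also have "\<dots> = (\<bar>?J\<bar> * real N - \<epsilon> / 2) / real N"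
          using le[of m] len[of m] by simp
        also have "\<dots> < \<bar>?J\<bar>" using elim(2) \<epsilon> by (simp add: field_simps)
        finally show False by simp
      qed
      then obtain y where y: "\<And>m. m < N \<Longrightarrow> y m \<in> ?c m" "\<And>m. m < N \<Longrightarrow>
          \<bar>integral (?c m) g - g (t m) / real N\<bar> \<le> (\<bar>g (t m) - g (y m)\<bar> + \<epsilon> / 2) / real N"
        by metis
      have "\<bar>(\<Sum>m<n. g (t m)) / real N - integral {0..real n / real N} g\<bar>
          = \<bar>\<Sum>m<n. integral (?c m) g - g (t m) / real N\<bar>"
        unfolding split by (simp add: sum_subtractf sum_divide_distrib abs_minus_commute)
      also have "\<dots> \<le> (\<Sum>m<n. (\<bar>g (t m) - g (y m)\<bar> + \<epsilon> / 2) / real N)"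
        using y n by (intro sum_abs[THEN order_trans] sum_mono) auto
      \<comment> \<open>All summands are nonnegative, so passing to the full range gives a bound
        independent of \<open>n\<close>.\<close>
      also have "\<dots> \<le> (\<Sum>m<N. (\<bar>g (t m) - g (y m)\<bar> + \<epsilon> / 2) / real N)"
        using n \<epsilon> by (intro sum_mono2) auto
      also have "\<dots> = (\<Sum>m<N. \<bar>g (t m) - g (y m)\<bar>) / real N + \<epsilon> / 2"
        using elim(2) by (simp add: sum.distrib add_divide_distrib flip: sum_divide_distrib)
      also have "\<dots> \<le> \<epsilon>"
      proof -
        have "cell_tags N y" using y(1) by (simp add: cell_tags_def)
        from elim(1)[rule_format, OF t this] show ?thesis by linarith
      qed
      finally show "\<bar>(\<Sum>m<n. g (t m)) / real N - integral {0..real n / real N} g\<bar> \<le> \<epsilon>" .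
    qed
  qed
qed

section \<open>The variance profile\<close>

text \<open>Split at y = x and take the distance |x - y| as the new variable. Continuity of
  \<open>phi\<close> and the convergence of the row sums then both reduce to integrals of the
  squared profile from 0 to a variable upper limit.\<close>

lemma phi_eq:
  assumes int: "(\<lambda>z. (\<alpha> z)\<^sup>2) integrable_on {0..1}" and x: "x \<in> {0..1}"
  shows "phi \<alpha> x = integral {0..x} (\<lambda>z. (\<alpha> z)\<^sup>2) + integral {0..1 - x} (\<lambda>z. (\<alpha> z)\<^sup>2)"
proof -
  let ?g = "\<lambda>z. (\<alpha> z)\<^sup>2"
  have part: "(?g has_integral integral {0..c} ?g) (cbox 0 c)" if "c \<in> {0..1}" for c
    using integrable_integral[OF integrable_on_subinterval[OF int, of 0 c]] that by simp
  have "((\<lambda>y. ?g (- 1 *\<^sub>R y + x)) has_integral (1 / \<bar>- 1\<bar> ^ DIM(real)) *\<^sub>R integral {0..x} ?g)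
      ((\<lambda>y. (1 / - 1) *\<^sub>R y + - ((1 / - 1) *\<^sub>R x)) ` cbox 0 x)"
    by (rule has_integral_affinity[OF part[OF x]]) simp
  moreover have "(\<lambda>y. (1 / - 1) *\<^sub>R y + - ((1 / - 1) *\<^sub>R x)) ` cbox 0 x = {0..x}"
    by (auto simp: image_iff intro!: bexI[of _ "x - _"])
  ultimately have "((\<lambda>y. ?g (x - y)) has_integral integral {0..x} ?g) {0..x}" by simp
  then have left: "((\<lambda>y. ?g \<bar>x - y\<bar>) has_integral integral {0..x} ?g) {0..x}"
    by (rule has_integral_eq[rotated]) auto
  have "((\<lambda>y. ?g (1 *\<^sub>R y + - x)) has_integral (1 / \<bar>1\<bar> ^ DIM(real)) *\<^sub>R integral {0..1 - x} ?g)
      ((\<lambda>y. (1 / 1) *\<^sub>R y + - ((1 / 1) *\<^sub>R - x)) ` cbox 0 (1 - x))"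
    using x by (intro has_integral_affinity[OF part]) auto
  moreover have "(\<lambda>y. (1 / 1) *\<^sub>R y + - ((1 / 1) *\<^sub>R - x)) ` cbox 0 (1 - x) = {x..1}"
    by (auto simp: image_iff intro!: bexI[of _ "_ - x"])
  ultimately have "((\<lambda>y. ?g (y - x)) has_integral integral {0..1 - x} ?g) {x..1}" by simp
  then have right: "((\<lambda>y. ?g \<bar>x - y\<bar>) has_integral integral {0..1 - x} ?g) {x..1}"
    by (rule has_integral_eq[rotated]) auto
  have "((\<lambda>y. ?g \<bar>x - y\<bar>) has_integral integral {0..x} ?g + integral {0..1 - x} ?g) {0..1}"
    using x by (intro has_integral_combine[OF _ _ left right]) auto
  then show ?thesis unfolding phi_def by (rule integral_unique)
qed

lemma continuous_on_phi:
  assumes int: "(\<lambda>z. (\<alpha> z)\<^sup>2) integrable_on {0..1}"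
  shows "continuous_on {0..1} (phi \<alpha>)"
proof -
  have A: "continuous_on {0..1} (\<lambda>x. integral {0..x} (\<lambda>z. (\<alpha> z)\<^sup>2))"
    by (rule indefinite_integral_continuous_1[OF int])
  have "continuous_on {0..1} (\<lambda>x. integral {0..1 - x} (\<lambda>z. (\<alpha> z)\<^sup>2))"
    by (rule continuous_on_compose2[OF A]) (auto intro!: continuous_intros)
  with A have "continuous_on {0..1} (\<lambda>x. integral {0..x} (\<lambda>z. (\<alpha> z)\<^sup>2) + integral {0..1 - x} (\<lambda>z. (\<alpha> z)\<^sup>2))"
    by (rule continuous_on_add)
  then show ?thesis by (rule continuous_on_eq) (simp add: phi_eq[OF int])
qed

text \<open>The discrete analogue of \<open>phi_eq\<close>. The diagonal term u = v goes to the
  first sum, which therefore runs over left end points of cells, and the second over right end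
  points; both are admissible tags.\<close>

lemma sum_abs_diff_split:
  assumes "v \<in> {1..N}"
  shows "(\<Sum>u\<in>{1..N}. g (\<bar>real v - real u\<bar> / real N)) =
     (\<Sum>m<v. g (real m / real N)) + (\<Sum>m<N - v. g (real (Suc m) / real N))"
proof -
  have "{1..N} = {1..v} \<union> {Suc v..N}" "{1..v} \<inter> {Suc v..N} = {}" using assms by auto
  then have "(\<Sum>u\<in>{1..N}. g (\<bar>real v - real u\<bar> / real N)) =
      (\<Sum>u\<in>{1..v}. g (\<bar>real v - real u\<bar> / real N)) + (\<Sum>u\<in>{Suc v..N}. g (\<bar>real v - real u\<bar> / real N))"
    by (metis sum.union_disjoint finite_atLeastAtMost)
  also have "(\<Sum>u\<in>{1..v}. g (\<bar>real v - real u\<bar> / real N)) = (\<Sum>m<v. g (real m / real N))"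
    by (rule sum.reindex_bij_witness[of _ "\<lambda>m. v - m" "\<lambda>u. v - u"]) (auto simp: of_nat_diff)
  also have "(\<Sum>u\<in>{Suc v..N}. g (\<bar>real v - real u\<bar> / real N)) = (\<Sum>m<N - v. g (real (Suc m) / real N))"
    by (rule sum.reindex_bij_witness[of _ "\<lambda>m. v + Suc m" "\<lambda>u. u - Suc v"]) (auto simp: of_nat_diff)
  finally show ?thesis .
qed

lemma riemann_sum_phi:
  assumes int: "(\<lambda>z. (\<alpha> z)\<^sup>2) integrable_on {0..1}" and osc: "vanishing_oscillation (\<lambda>z. (\<alpha> z)\<^sup>2)"
    and \<epsilon>: "\<epsilon> > 0"
  shows "\<forall>\<^sub>F N in sequentially. \<forall>v\<in>{1..N}.
    \<bar>(\<Sum>u\<in>{1..N}. (\<alpha> (\<bar>real v - real u\<bar> / real N))\<^sup>2) / real N - phi \<alpha> (real v / real N)\<bar> \<le> \<epsilon>"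
  using riemann_sum_uniform[OF int osc half_gt_zero[OF \<epsilon>]] eventually_ge_at_top[of 1]
proof eventually_elim
  case (elim N)
  let ?g = "\<lambda>z. (\<alpha> z)\<^sup>2"
  show ?case
  proof
    fix v assume v: "v \<in> {1..N}"
    have x: "real v / real N \<in> {0..1}" using v by auto
    have tags: "cell_tags N (\<lambda>m. real m / real N)" "cell_tags N (\<lambda>m. real (Suc m) / real N)"
      by (auto simp: cell_tags_def divide_right_mono)
    have eq: "real (N - v) / real N = 1 - real v / real N"
      using v by (simp add: of_nat_diff field_simps)
    have "\<bar>(\<Sum>m<v. ?g (real m / real N)) / real N - integral {0..real v / real N} ?g\<bar> \<le> \<epsilon> / 2"
      using elim(1)[rule_format, OF tags(1), of v] v by simp
    moreover have "\<bar>(\<Sum>m<N - v. ?g (real (Suc m) / real N)) / real N - integral {0..1 - real v / real N} ?g\<bar> \<le> \<epsilon> / 2"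
      using elim(1)[rule_format, OF tags(2), of "N - v"] unfolding eq by simp
    ultimately show "\<bar>(\<Sum>u\<in>{1..N}. ?g (\<bar>real v - real u\<bar> / real N)) / real N - phi \<alpha> (real v / real N)\<bar> \<le> \<epsilon>"
      unfolding phi_eq[OF int x] sum_abs_diff_split[OF v, of ?g] add_divide_distrib by linarith
  qed
qed

text \<open>Passes from averages over lattice points to every single point: the averages converge to
  the integral, and continuity excludes exceptional points.\<close>

lemma eq_0_if_riemann_sums_vanish:
  assumes cont: "continuous_on {0..1} f" and nonneg: "\<And>x. 0 \<le> f x"
    and lim: "(\<lambda>N. (\<Sum>v\<in>{1..N}. f (real v / real N)) / real N) \<longlonglongrightarrow> 0"
    and x: "x \<in> {0..1}"
  shows "f x = 0"
proof -
  have int: "f integrable_on {0..1}" using cont by (rule integrable_continuous_interval)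
  have "(\<lambda>N. (\<Sum>v\<in>{1..N}. f (real v / real N)) / real N) \<longlonglongrightarrow> integral {0..1} f"
  proof (rule tendstoI)
    fix \<epsilon> :: real assume "\<epsilon> > 0"
    from riemann_sum_uniform[OF int vanishing_oscillation_continuous[OF cont] half_gt_zero[OF this]]
      eventually_ge_at_top[of 1]
    show "\<forall>\<^sub>F N in sequentially. dist ((\<Sum>v\<in>{1..N}. f (real v / real N)) / real N) (integral {0..1} f) < \<epsilon>"
    proof eventually_elim
      case (elim N)
      have "cell_tags N (\<lambda>m. real (Suc m) / real N)"
        by (auto simp: cell_tags_def divide_right_mono)
      from elim(1)[rule_format, OF this, of N]
      have "\<bar>(\<Sum>m<N. f (real (Suc m) / real N)) / real N - integral {0..1} f\<bar> \<le> \<epsilon> / 2"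
        using elim(2) by simp
      moreover have "(\<Sum>m<N. f (real (Suc m) / real N)) = (\<Sum>v\<in>{1..N}. f (real v / real N))"
        by (rule sum.reindex_bij_witness[of _ "\<lambda>v. v - 1" Suc]) auto
      ultimately show ?case using \<open>\<epsilon> > 0\<close> by (simp only: dist_real_def)
    qed
  qed
  with lim have "integral {0..1} f = 0" using LIMSEQ_unique by blast
  then show ?thesis
    using integral_eq_0_iff[OF cont _ nonneg] x by auto
qed

theorem mainTheorem11:
  fixes \<alpha> :: "real \<Rightarrow> real"
    and M :: "'a measure"
    and X :: "nat \<Rightarrow> nat \<Rightarrow> nat \<Rightarrow> 'a \<Rightarrow> real"
    and rel :: "nat \<Rightarrow> ((nat \<times> nat) \<times> (nat \<times> nat)) set"
    and R :: "nat \<Rightarrow> real"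
  assumes alpha_bdd: "bounded (\<alpha> ` {0..1})"
    and alpha_riemann: "riemann_integrable_on \<alpha> 0 1"
    and prob: "prob_space M"
    and meas: "\<And>N i j. X N i j \<in> borel_measurable M"
    and symm: "\<And>N i j \<omega>. X N i j \<omega> = X N j i \<omega>"
    and mean0: "\<And>N i j. i \<in> {1..N} \<Longrightarrow> j \<in> {1..N} \<Longrightarrow> integral\<^sup>L M (X N i j) = 0"
    and var1: "\<And>N i j. i \<in> {1..N} \<Longrightarrow> j \<in> {1..N} \<Longrightarrow> integral\<^sup>L M (\<lambda>\<omega>. (X N i j \<omega>)^2) = 1"
    and mom_int: "\<And>N i j k. i \<in> {1..N} \<Longrightarrow> j \<in> {1..N} \<Longrightarrow> k \<ge> 1 \<Longrightarrow>
                    integrable M (\<lambda>\<omega>. \<bar>X N i j \<omega>\<bar> ^ k)"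
    and mom_bdd: "\<And>N i j k. i \<in> {1..N} \<Longrightarrow> j \<in> {1..N} \<Longrightarrow> k \<ge> 1 \<Longrightarrow>
                    integral\<^sup>L M (\<lambda>\<omega>. \<bar>X N i j \<omega>\<bar> ^ k) \<le> R k"
    and equiv: "\<And>N. equiv ({1..N} \<times> {1..N}) (rel N)"
    and rel_sym: "\<And>N p q. p \<in> {1..N} \<Longrightarrow> q \<in> {1..N} \<Longrightarrow> ((p, q), (q, p)) \<in> rel N"
    and C1: "(\<lambda>N. real (Max ((\<lambda>p. card {(q, r, s). q \<in> {1..N} \<and> r \<in> {1..N} \<and> s \<in> {1..N}
                      \<and> ((p, q), (r, s)) \<in> rel N}) ` {1..N})) / (real N)^2) \<longlonglongrightarrow> 0"
    and C2: "\<exists>B::nat. \<forall>N p q r. p \<in> {1..N} \<longrightarrow> q \<in> {1..N} \<longrightarrow> r \<in> {1..N} \<longrightarrow>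
                card {s \<in> {1..N}. ((p, q), (r, s)) \<in> rel N} \<le> B"
    and C3: "(\<lambda>N. real (card {(p, q, r). p \<in> {1..N} \<and> q \<in> {1..N} \<and> r \<in> {1..N}
                      \<and> ((p, q), (q, r)) \<in> rel N \<and> r \<noteq> p}) / (real N)^2) \<longlonglongrightarrow> 0"
    and indep: "\<And>N. prob_space.indep_vars M
                  (\<lambda>C. PiM C (\<lambda>_. borel))
                  (\<lambda>C \<omega>. restrict (\<lambda>(p, q). X N p q \<omega>) C)
                  (({1..N} \<times> {1..N}) // rel N)"
    and phi0_pos: "phi0 \<alpha> > 0"
  shows "(\<forall>k::nat. (\<lambda>N. integral\<^sup>L M (\<lambda>\<omega>. mtrace N (mpow N
              (\<lambda>i j. (phi0 \<alpha>) powr (-1/2) * bandM \<alpha> X N \<omega> i j) k)) / real N)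
            \<longlonglongrightarrow> (if even k then catalan (k div 2) else 0))
         \<longleftrightarrow> (\<forall>x\<in>{0..1}. phi \<alpha> x = phi0 \<alpha>)"
proof -
  obtain c where "\<forall>y\<in>\<alpha> ` {0..1}. norm y \<le> c"
    using alpha_bdd unfolding bounded_iff by blast
  then have c: "\<bar>\<alpha> x\<bar> \<le> c" if "x \<in> {0..1}" for x using that by simp
  have c0: "c \<ge> 0" using c[of 0] by force
  have int: "(\<lambda>z. (\<alpha> z)\<^sup>2) integrable_on {0..1}"
    using integrable_on_square_bounded[OF riemann_integrable_on_imp_integrable_on[OF alpha_riemann] c] by simp
  have osc: "vanishing_oscillation (\<lambda>z. (\<alpha> z)\<^sup>2)"
    using vanishing_oscillation_square[OF vanishing_oscillation_riemann[OF alpha_riemann] c] by simp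
  obtain B where B: "\<And>N p q r. p \<in> {1..N} \<Longrightarrow> q \<in> {1..N} \<Longrightarrow> r \<in> {1..N} \<Longrightarrow>
      card {s \<in> {1..N}. ((p, q), (r, s)) \<in> rel N} \<le> B"
    using C2 by blast
  define w where "w = phi0 \<alpha> powr (-1/2)"
  have w: "w \<ge> 0" "w\<^sup>2 = 1 / phi0 \<alpha>"
    using phi0_pos by (auto simp: w_def powr_minus_divide power_divide powr_half_sqrt)
  \<comment> \<open>The normalisation is absorbed into the weights, so that the row sums approximate
    \<open>phi\<close> divided by \<open>phi0\<close>.\<close>
  define a where "a N i j = w * (1 / sqrt (real N) * \<alpha> (\<bar>real i - real j\<bar> / real N))" for N i j :: nat
  interpret prob_space M by (rule prob)
  interpret symmetric_weighted_ensemble M X rel R B a "w * c"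
  proof unfold_locales
    show "\<bar>a N i j\<bar> \<le> w * c / sqrt (real N)" if "i \<in> {1..N}" "j \<in> {1..N}" for N i j
    proof -
      have "\<bar>real i - real j\<bar> / real N \<in> {0..1}" using that by (auto simp: divide_simps)
      then have "w * (\<bar>\<alpha> (\<bar>real i - real j\<bar> / real N)\<bar> / sqrt (real N)) \<le> w * (c / sqrt (real N))"
        using w(1) by (intro mult_left_mono divide_right_mono c) auto
      then show ?thesis using w(1) by (simp add: a_def abs_mult)
    qed
    show "a N i j = a N j i" for N i j by (simp add: a_def abs_minus_commute)
    show "0 \<le> w * c" using w c0 by simp
  qed (fact meas symm mean0 var1 mom_int mom_bdd equiv rel_sym C1 B C3 indep)+
  have moment: "integral\<^sup>L M (\<lambda>\<omega>. mtrace N (mpow N (\<lambda>i j. phi0 \<alpha> powr (-1/2) * bandM \<alpha> X N \<omega> i j) k)) / real N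
      = trace_moment k N" for k N
    by (simp add: trace_moment_def bandM_def a_def w_def mult.assoc)
  have row: "row_sum N v = ((\<Sum>u\<in>{1..N}. (\<alpha> (\<bar>real v - real u\<bar> / real N))\<^sup>2) / real N) / phi0 \<alpha>" for N v
    by (simp add: row_sum_def a_def power_mult_distrib power_divide w(2) sum_divide_distrib mult_ac)
  have rows: "\<forall>\<^sub>F N in sequentially. \<forall>v\<in>{1..N}. \<bar>row_sum N v - phi \<alpha> (real v / real N) / phi0 \<alpha>\<bar> \<le> \<epsilon>"
    if "\<epsilon> > 0" for \<epsilon>
    using riemann_sum_phi[OF int osc mult_pos_pos[OF that phi0_pos]]
  proof eventually_elim
    case (elim N)
    then show ?case
      using phi0_pos unfolding row diff_divide_distrib[symmetric] abs_divide
      by (auto simp: pos_divide_le_eq)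
  qed
  show ?thesis
    unfolding moment
  proof
    assume sc: "\<forall>k. trace_moment k \<longlonglongrightarrow> (if even k then catalan (k div 2) else 0)"
    have "catalan 1 = 1" "catalan 2 = 2" by (simp_all add: catalan_def numeral_eq_Suc)
    then have var: "(\<lambda>N. (\<Sum>v\<in>{1..N}. (row_sum N v - 1)\<^sup>2) / real N) \<longlonglongrightarrow> 0"
      using sc[rule_format, of 2] sc[rule_format, of 4] by (intro row_sum_variance) simp_all
    let ?f = "\<lambda>x. (phi \<alpha> x / phi0 \<alpha> - 1)\<^sup>2"
    have "(\<lambda>N. (\<Sum>v\<in>{1..N}. ?f (real v / real N)) / real N) \<longlonglongrightarrow> 0"
    proof (rule tendstoI)
      fix \<epsilon> :: real assume \<epsilon>: "\<epsilon> > 0"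
      \<comment> \<open>With r the row sum and y the value that it approximates, (y - 1)^2 \<le> 2
        (r - 1)^2 + 2 (r - y)^2. Means below \<open>\<epsilon> / 4\<close> for the first square and
        a bound \<open>\<epsilon> / 4\<close> for the second keep the mean of \<open>?f\<close>
        below \<open>\<epsilon>\<close>.\<close>
      define \<delta> where "\<delta> = sqrt (\<epsilon> / 4)"
      have \<delta>: "\<delta> > 0" "\<delta>\<^sup>2 = \<epsilon> / 4" using \<epsilon> by (auto simp: \<delta>_def)
      have "\<forall>\<^sub>F N in sequentially. (\<Sum>v\<in>{1..N}. (row_sum N v - 1)\<^sup>2) / real N < \<epsilon> / 4"
        using order_tendstoD(2)[OF var, of "\<epsilon> / 4"] \<epsilon> by simp
      with rows[OF \<delta>(1)] show "\<forall>\<^sub>F N in sequentially. dist ((\<Sum>v\<in>{1..N}. ?f (real v / real N)) / real N) 0 < \<epsilon>"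
        using eventually_ge_at_top[of 1]
      proof eventually_elim
        case (elim N)
        have "?f (real v / real N) \<le> 2 * (row_sum N v - 1)\<^sup>2 + 2 * \<delta>\<^sup>2" if v: "v \<in> {1..N}" for v
        proof -
          let ?y = "phi \<alpha> (real v / real N) / phi0 \<alpha>"
          have "(row_sum N v - ?y)\<^sup>2 \<le> \<delta>\<^sup>2"
            using elim(1) v \<delta>(1) by (simp add: abs_le_square_iff[symmetric])
          moreover have "(?y - 1)\<^sup>2 \<le> 2 * (row_sum N v - 1)\<^sup>2 + 2 * (row_sum N v - ?y)\<^sup>2"
            using zero_le_power2[of "(row_sum N v - 1) + (row_sum N v - ?y)"]
            by (simp add: power2_eq_square algebra_simps)
          ultimately show ?thesis by simp
        qed
        then have "(\<Sum>v\<in>{1..N}. ?f (real v / real N)) / real N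
            \<le> (\<Sum>v\<in>{1..N}. 2 * (row_sum N v - 1)\<^sup>2 + 2 * \<delta>\<^sup>2) / real N"
          by (intro divide_right_mono sum_mono) auto
        also have "\<dots> = 2 * ((\<Sum>v\<in>{1..N}. (row_sum N v - 1)\<^sup>2) / real N) + 2 * \<delta>\<^sup>2"
          using elim(3) by (simp add: sum.distrib add_divide_distrib sum_distrib_left[symmetric])
        also have "\<dots> < \<epsilon>" using elim(2) \<delta>(2) by linarith
        finally show ?case by (simp add: dist_real_def sum_nonneg)
      qed
    qed
    moreover have "continuous_on {0..1} ?f"
      using phi0_pos by (intro continuous_intros continuous_on_phi[OF int]) auto
    ultimately have "?f x = 0" if "x \<in> {0..1}" for x
      using that by (intro eq_0_if_riemann_sums_vanish[of ?f x]) auto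
    then show "\<forall>x\<in>{0..1}. phi \<alpha> x = phi0 \<alpha>" using phi0_pos by auto
  next
    assume const: "\<forall>x\<in>{0..1}. phi \<alpha> x = phi0 \<alpha>"
    have "\<forall>\<^sub>F N in sequentially. \<forall>v\<in>{1..N}. \<bar>row_sum N v - 1\<bar> \<le> \<epsilon>" if "\<epsilon> > 0" for \<epsilon>
      using rows[OF that]
    proof eventually_elim
      case (elim N)
      have "phi \<alpha> (real v / real N) / phi0 \<alpha> = 1" if "v \<in> {1..N}" for v
        using const[rule_format, of "real v / real N"] that phi0_pos by auto
      with elim show ?case by simp
    qed
    then show "\<forall>k. trace_moment k \<longlonglongrightarrow> (if even k then catalan (k div 2) else 0)"
      using trace_moment_catalan by blast
  qed
qed

end
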